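(* Let $d\ge1$ and $0<\alpha<2$. Let $p_t(x,y)$ be the transition density of the symmetric $\alpha$-stable process in $\mathbb{R}^d$. There exists a constant $c_1>0$, depending only on $d$ and $\alpha$, such that the following hold for all $x\in\mathbb{R}^d\setminus\{0\}$ and all $t>0$. (a) $|p_1(0,x)|\le c_1\,(1\wedge|x|^{-(d+\alpha)})$, and for $k=1,2$, $$|\partial^kp_1(0,x)|\le c_1\,\big(1\wedge|x|^{-(d+\alpha+k)}\big).$$ (b) $|p_t(0,x)|\le c_1\,t^{-d/\alpha}\big(1\wedge(t^{1/\alpha}|x|^{-1})\big)^{d+\alpha}$, and for $k=1,2$, $$|\partial^kp_t(0,x)|\le c_1\,t^{-(d+k)/\alpha}\big(1\wedge(t^{1/\alpha}|x|^{-1})\big)^{d+\alpha+k}.$$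
   Context: The symmetric $\alpha$-stable process in $\mathbb{R}^d$ is the Lévy process $X_t$ with $\mathbb{E}\,e^{iu\cdot(X_t-X_0)}=e^{-t|u|^\alpha}$ for $u\in\mathbb{R}^d$; thus $p_t(0,x)=(2\pi)^{-d}\int_{\mathbb{R}^d}e^{-iu\cdot x}e^{-t|u|^\alpha}\,du$. Here $\partial^k$ stands for any partial derivative of order $k$ with respect to the variable $x$. Notation: $a\wedge b=\min\{a,b\}$; $|\cdot|$ is the Euclidean norm on $\mathbb{R}^d$. *)

theory Defs
  imports "HOL-Probability.Probability" "HOL-Real_Asymp.Real_Asymp"
begin

(* The transition density p_t(x,y), in its continuous version given by Fourier inversion and
   translation invariance.  Taking the real part only changes the type: the integral is real, see
   stable_density_eq_Fourier.  That this function is the transition density of every process whose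
   increments X_t - X_0 have characteristic function exp(-t |u|^alpha) is proved in
   stable_density_transition. *)
definition stable_density :: "real \<Rightarrow> real \<Rightarrow> 'a::euclidean_space \<Rightarrow> 'a \<Rightarrow> real" where
  "stable_density \<alpha> t x y =
     Re (1 / (2 * pi) ^ DIM('a) *
         (CLINT u | lborel. exp (- \<i> * (u \<bullet> (y - x))) * exp (- t * norm u powr \<alpha>)))"

definition partial :: "'a::real_vector \<Rightarrow> ('a \<Rightarrow> real) \<Rightarrow> 'a \<Rightarrow> real" where
  "partial b f x = deriv (\<lambda>s. f (x + s *\<^sub>R b)) 0"

fun partials :: "'a::real_vector list \<Rightarrow> ('a \<Rightarrow> real) \<Rightarrow> 'a \<Rightarrow> real" where
  "partials [] f = f"
| "partials (b # bs) f = partial b (partials bs f)"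

(* deriv has an arbitrary value where the derivative does not exist, so existence is stated
   separately: the inner derivatives near x, the outermost one at x. *)
fun partials_exist :: "'a::real_normed_vector list \<Rightarrow> ('a \<Rightarrow> real) \<Rightarrow> 'a \<Rightarrow> bool" where
  "partials_exist [] f x \<longleftrightarrow> True"
| "partials_exist (b # bs) f x \<longleftrightarrow>
     (\<forall>\<^sub>F y in nhds x. partials_exist bs f y) \<and>
     (\<lambda>s. partials bs f (x + s *\<^sub>R b)) differentiable (at 0)"


subsection \<open>The Fourier integral is the transition density\<close>

lemma integrable_exp_neg_powr_real:
  fixes c \<alpha> :: real
  assumes "0 < c" "0 < \<alpha>"
  shows "integrable lborel (\<lambda>x::real. exp (- c * \<bar>x\<bar> powr \<alpha>))"
proof -
  have "((\<lambda>x. exp (- c * x powr \<alpha>) * (1 + x^2)) \<longlongrightarrow> 0) at_top"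
    using assms by real_asymp
  then have "\<forall>\<^sub>F x in at_top. exp (- c * x powr \<alpha>) * (1 + x^2) < 1"
    by (rule order_tendstoD) simp
  then obtain N where N: "\<And>x. x \<ge> N \<Longrightarrow> exp (- c * x powr \<alpha>) * (1 + x^2) < 1"
    by (auto simp: eventually_at_top_linorder)
  have "exp (- c * \<bar>x\<bar> powr \<alpha>) * (1 + x^2) \<le> 2 + N\<^sup>2" for x
  proof (cases "\<bar>x\<bar> \<ge> N")
    case True
    have "0 \<le> N\<^sup>2" by simp
    with N[OF True] show ?thesis unfolding power2_abs by linarith
  next
    case False
    then have "x\<^sup>2 \<le> N\<^sup>2" by (simp add: abs_le_square_iff[symmetric])
    moreover have "exp (- c * \<bar>x\<bar> powr \<alpha>) \<le> 1" using assms by simp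
    ultimately have "exp (- c * \<bar>x\<bar> powr \<alpha>) * (1 + x^2) \<le> 1 * (1 + N\<^sup>2)"
      by (intro mult_mono) auto
    then show ?thesis by simp
  qed
  then have le: "exp (- c * \<bar>x\<bar> powr \<alpha>) \<le> (2 + N\<^sup>2) * inverse (1 + x\<^sup>2)" for x
    by (simp add: field_simps add_pos_nonneg)
  have "integrable lborel (\<lambda>x::real. (2 + N\<^sup>2) * inverse (1 + x\<^sup>2))"
    using integrable_inverse_1_plus_square by (simp add: set_integrable_def)
  then show ?thesis
    by (rule Bochner_Integration.integrable_bound) (use le in \<open>auto intro!: AE_I2\<close>)
qed

lemma integrable_lborel_prod_Basis:
  fixes f :: "'a::euclidean_space \<Rightarrow> real \<Rightarrow> 'b::{real_normed_field,banach,second_countable_topology}"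
  assumes int: "\<And>b. b \<in> Basis \<Longrightarrow> integrable lborel (f b)"
  shows "integrable lborel (\<lambda>x::'a. \<Prod>b\<in>Basis. f b (x \<bullet> b))"
    and "(LINT x|lborel. (\<Prod>b\<in>Basis. f b (x \<bullet> b))) = (\<Prod>b\<in>Basis. LINT s|lborel. f b s)"
proof -
  interpret product_sigma_finite "\<lambda>b::'a. lborel :: real measure" ..
  have [measurable]: "b \<in> Basis \<Longrightarrow> f b \<in> borel_measurable borel" for b
    using borel_measurable_integrable[OF int] by simp
  have m: "(\<lambda>x::'a. \<Prod>b\<in>Basis. f b (x \<bullet> b)) \<in> borel_measurable borel"
    by measurable
  have T: "(\<lambda>g. \<Sum>b\<in>Basis. g b *\<^sub>R b) \<in> (\<Pi>\<^sub>M b\<in>Basis. lborel) \<rightarrow>\<^sub>M (borel :: 'a measure)"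
    by measurable
  have eq: "(\<Prod>b\<in>Basis. f b ((\<Sum>i\<in>Basis. g i *\<^sub>R i :: 'a) \<bullet> b)) = (\<Prod>b\<in>Basis. f b (g b))" for g
    by (intro prod.cong) auto
  show "integrable lborel (\<lambda>x::'a. \<Prod>b\<in>Basis. f b (x \<bullet> b))"
    unfolding lborel_eq[where 'a='a] integrable_distr_eq[OF T m] eq
    by (rule product_integrable_prod) (use int in auto)
  show "(LINT x|lborel. (\<Prod>b\<in>Basis. f b (x \<bullet> b))) = (\<Prod>b\<in>Basis. LINT s|lborel. f b s)"
    unfolding lborel_eq[where 'a='a] integral_distr[OF T m] eq
    by (rule product_integral_prod) (use int in auto)
qed

lemma integrable_exp_neg_norm_powr:
  fixes t \<alpha> :: real
  assumes "0 < t" "0 < \<alpha>"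
  shows "integrable lborel (\<lambda>u::'a::euclidean_space. exp (- t * norm u powr \<alpha>))"
proof -
  let ?c = "t / DIM('a)"
  have "integrable lborel (\<lambda>u::'a. \<Prod>b\<in>Basis. exp (- ?c * \<bar>u \<bullet> b\<bar> powr \<alpha>))"
    by (rule integrable_lborel_prod_Basis(1), rule integrable_exp_neg_powr_real)
       (use assms in auto)
  then show ?thesis
  proof (rule Bochner_Integration.integrable_bound)
    have "exp (- t * norm u powr \<alpha>) \<le> (\<Prod>b\<in>Basis. exp (- ?c * \<bar>u \<bullet> b\<bar> powr \<alpha>))" for u :: 'a
    proof -
      have "(\<Sum>b\<in>Basis. ?c * \<bar>u \<bullet> b\<bar> powr \<alpha>) \<le> (\<Sum>b\<in>(Basis::'a set). ?c * norm u powr \<alpha>)"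
        using assms by (intro sum_mono mult_left_mono powr_mono2) (auto intro: Basis_le_norm)
      then show ?thesis by (simp add: exp_sum[symmetric] sum_negf)
    qed
    then show "AE u in lborel. norm (exp (- t * norm u powr \<alpha>))
        \<le> norm (\<Prod>b\<in>(Basis::'a set). exp (- ?c * \<bar>u \<bullet> b\<bar> powr \<alpha>))"
      by (intro AE_I2) (simp add: abs_prod)
  qed measurable
qed

definition gauss :: "real \<Rightarrow> 'a::euclidean_space \<Rightarrow> real" where
  "gauss s x = (1 / (sqrt (2 * pi) * s)) ^ DIM('a) * exp (- (norm x / s)\<^sup>2 / 2)"

lemma gauss_fourier:
  fixes v :: "'a::euclidean_space"
  shows "integrable lborel (\<lambda>z::'a. exp (- (norm z)\<^sup>2 / 2))"
    and "(CLINT z|lborel. iexp (v \<bullet> z) * exp (- (norm z)\<^sup>2 / 2)) =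
         (sqrt (2 * pi)) ^ DIM('a) * exp (- (norm v)\<^sup>2 / 2)"
proof -
  have n2: "(norm z)\<^sup>2 = (\<Sum>b\<in>Basis. (z \<bullet> b)\<^sup>2)" for z :: 'a
    by (subst norm_eq_sqrt_inner, subst euclidean_inner) (simp add: power2_eq_square sum_nonneg)
  have e: "exp (- (norm z)\<^sup>2 / 2) = (\<Prod>b\<in>Basis. exp (- (z \<bullet> b)\<^sup>2 / 2))" for z :: 'a
    by (simp add: n2 exp_sum[symmetric] sum_negf sum_divide_distrib)
  have i0: "integrable lborel (\<lambda>s::real. exp (- s\<^sup>2 / 2))"
    using integrable_mult_right[OF integrable_normal_density[of 1 0], of "sqrt (2*pi)"]
    by (simp add: std_normal_density_def)
  show "integrable lborel (\<lambda>z::'a. exp (- (norm z)\<^sup>2 / 2))"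
    unfolding e by (rule integrable_lborel_prod_Basis) (rule i0)
  have i1: "integrable lborel (\<lambda>s::real. iexp (r * s) * exp (- s\<^sup>2 / 2))" for r
    by (rule Bochner_Integration.integrable_bound[OF i0]) (auto simp: norm_mult)
  have f1: "(CLINT s|lborel. iexp (r * s) * exp (- s\<^sup>2 / 2)) = sqrt (2 * pi) * exp (- r\<^sup>2 / 2)" for r
  proof -
    have "char std_normal_distribution r = exp (- r\<^sup>2 / 2)"
      by (simp add: char_std_normal_distribution)
    then have "(CLINT s|lborel. std_normal_density s *\<^sub>R iexp (r * s)) = exp (- r\<^sup>2 / 2)"
      unfolding char_def by (subst (asm) integral_density) auto
    then have *: "(CLINT s|lborel. complex_of_real (1 / sqrt (2*pi)) * (iexp (r * s) * exp (- s\<^sup>2 / 2))) = exp (- r\<^sup>2 / 2)"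
      by (simp add: std_normal_density_def scaleR_conv_of_real mult_ac)
    show ?thesis using * by (subst (asm) integral_mult_right_zero) (simp add: field_simps)
  qed
  have e2: "iexp (v \<bullet> z) * exp (- (norm z)\<^sup>2 / 2) =
      (\<Prod>b\<in>Basis. iexp ((v \<bullet> b) * (z \<bullet> b)) * exp (- (z \<bullet> b)\<^sup>2 / 2))" for z
    unfolding e prod.distrib of_real_prod
    by (subst euclidean_inner) (simp add: exp_sum[symmetric] sum_distrib_left)
  have "(CLINT z|lborel. iexp (v \<bullet> z) * exp (- (norm z)\<^sup>2 / 2)) =
      (\<Prod>b\<in>(Basis::'a set). sqrt (2 * pi) * exp (- (v \<bullet> b)\<^sup>2 / 2))"
    unfolding e2 by (subst integrable_lborel_prod_Basis(2), rule i1) (simp only: f1 of_real_prod)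
  then show "(CLINT z|lborel. iexp (v \<bullet> z) * exp (- (norm z)\<^sup>2 / 2)) =
         (sqrt (2 * pi)) ^ DIM('a) * exp (- (norm v)\<^sup>2 / 2)"
    by (simp only: e prod.distrib prod_constant of_real_mult of_real_power)
qed

lemma lborel_scale:
  fixes f :: "'a::euclidean_space \<Rightarrow> 'b::{banach,second_countable_topology}"
  assumes s: "s \<noteq> 0" and [measurable]: "f \<in> borel_measurable borel"
  shows "integrable lborel f \<longleftrightarrow> integrable lborel (\<lambda>x. f (a + s *\<^sub>R x))"
    and "(LINT x|lborel. f x) = \<bar>s\<bar> ^ DIM('a) *\<^sub>R (LINT x|lborel. f (a + s *\<^sub>R x))"
proof -
  have eq: "(lborel :: 'a measure) = density (distr lborel borel (\<lambda>x. a + s *\<^sub>R x)) (\<lambda>_. ennreal (\<bar>s\<bar> ^ DIM('a)))"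
    using lborel_affine[OF s, of a] by simp
  have [simp]: "integrable lborel (\<lambda>x. \<bar>s\<bar> ^ DIM('a) *\<^sub>R g x) \<longleftrightarrow> integrable lborel g" for g :: "'a \<Rightarrow> 'b"
  proof
    assume "integrable lborel (\<lambda>x. \<bar>s\<bar> ^ DIM('a) *\<^sub>R g x)"
    from integrable_scaleR_right[OF this, of "inverse (\<bar>s\<bar> ^ DIM('a))"] s
    show "integrable lborel g" by simp
  qed simp
  show "integrable lborel f \<longleftrightarrow> integrable lborel (\<lambda>x. f (a + s *\<^sub>R x))"
    by (subst eq, subst integrable_density) (auto simp: integrable_distr_eq)
  show "(LINT x|lborel. f x) = \<bar>s\<bar> ^ DIM('a) *\<^sub>R (LINT x|lborel. f (a + s *\<^sub>R x))"
    by (subst eq, subst integral_density) (auto simp: integral_distr)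
qed

lemma measurable_gauss [measurable]: "gauss s \<in> borel_measurable borel"
  unfolding gauss_def[abs_def] by measurable

lemma gauss_nonneg: "0 < s \<Longrightarrow> 0 \<le> gauss s x"
  by (simp add: gauss_def)

lemma gauss_scaleR: "0 < s \<Longrightarrow> gauss s (s *\<^sub>R z :: 'a) = gauss 1 z / s ^ DIM('a::euclidean_space)"
  by (simp add: gauss_def power_mult_distrib field_simps)

lemma gauss_integral:
  "integrable lborel (gauss 1 :: 'a::euclidean_space \<Rightarrow> real)" "(LINT z|lborel. gauss 1 (z::'a)) = 1"
proof -
  show "integrable lborel (gauss 1 :: 'a::euclidean_space \<Rightarrow> real)"
    unfolding gauss_def[abs_def] by (intro integrable_mult_right impI) (use gauss_fourier(1)[where 'a='a] in simp)
  have "complex_of_real (LINT z|lborel. exp (- (norm (z::'a))\<^sup>2 / 2)) = complex_of_real ((sqrt (2*pi)) ^ DIM('a))"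
    using gauss_fourier(2)[of "0::'a"] by (simp flip: integral_complex_of_real)
  then have "(LINT z|lborel. exp (- (norm (z::'a))\<^sup>2 / 2)) = (sqrt (2*pi)) ^ DIM('a)"
    unfolding of_real_eq_iff .
  then show "(LINT z|lborel. gauss 1 (z::'a)) = 1"
    by (simp add: gauss_def power_mult_distrib power_divide)
qed

lemma gauss_fourier_scaled:
  fixes v :: "'a::euclidean_space"
  assumes s: "0 < s"
  shows "integrable lborel (\<lambda>u::'a. exp (- (s * norm u)\<^sup>2 / 2))"
    and "(CLINT u|lborel. iexp (u \<bullet> v) * exp (- (s * norm u)\<^sup>2 / 2)) = (2 * pi) ^ DIM('a) * gauss s v"
proof -
  have [simp]: "s * (inverse s * r) = r" for r
    using s by simp
  show "integrable lborel (\<lambda>u::'a. exp (- (s * norm u)\<^sup>2 / 2))"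
    using lborel_scale(1)[of "inverse s" "\<lambda>u::'a. exp (- (s * norm u)\<^sup>2 / 2)" 0] s gauss_fourier(1)[where 'a='a]
    by simp
  have "(CLINT u|lborel. iexp (u \<bullet> v) * exp (- (s * norm u)\<^sup>2 / 2)) =
      inverse s ^ DIM('a) *\<^sub>R (CLINT u|lborel. iexp ((v /\<^sub>R s) \<bullet> u) * exp (- (norm u)\<^sup>2 / 2))"
    using s by (subst lborel_scale(2)[of "inverse s" _ 0]) (auto simp: inner_commute)
  also have "\<dots> = (2 * pi) ^ DIM('a) * gauss s v"
  proof -
    have n: "norm (v /\<^sub>R s) = norm v / s" using s by (simp add: divide_inverse)
    have p: "(2 * pi) ^ DIM('a) * (1 / (sqrt (2 * pi) * s)) ^ DIM('a) = inverse s ^ DIM('a) * sqrt (2 * pi) ^ DIM('a)"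
      unfolding power_mult_distrib[symmetric] using s
      by (intro arg_cong[where f="\<lambda>r. r ^ DIM('a)"]) (simp add: field_simps)
    have "inverse s ^ DIM('a) * (sqrt (2 * pi) ^ DIM('a) * exp (- (norm (v /\<^sub>R s))\<^sup>2 / 2)) = (2 * pi) ^ DIM('a) * gauss s v"
      unfolding gauss_def n mult.assoc[symmetric] p ..
    then show ?thesis
      by (simp only: gauss_fourier(2) scaleR_conv_of_real of_real_mult[symmetric])
  qed
  finally show "(CLINT u|lborel. iexp (u \<bullet> v) * exp (- (s * norm u)\<^sup>2 / 2)) = (2 * pi) ^ DIM('a) * gauss s v" .
qed

lemma density_of_integrable_char:
  fixes N :: "'a::euclidean_space measure" and \<phi> :: "'a \<Rightarrow> real" and f :: "'a \<Rightarrow> complex"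
  assumes N: "prob_space N" and sets[measurable_cong]: "sets N = sets borel"
    and \<phi>: "integrable lborel \<phi>"
    and char: "\<And>u. (CLINT y|N. iexp (u \<bullet> y)) = \<phi> u"
  defines "f \<equiv> \<lambda>x. 1 / (2 * pi) ^ DIM('a) * (CLINT u|lborel. exp (- \<i> * (u \<bullet> x)) * \<phi> u)"
  shows "0 \<le> Re (f x)" and "N = density lborel (\<lambda>x. ennreal (Re (f x)))"
proof -
  interpret N: prob_space N by (rule N)
  interpret P: pair_sigma_finite "lborel :: 'a measure" N ..
  interpret Q: pair_sigma_finite N "lborel :: 'a measure" ..
  have [measurable]: "\<phi> \<in> borel_measurable borel"
    using borel_measurable_integrable[OF \<phi>] by simp
  let ?C = "(2 * pi) ^ DIM('a)"
  define s where "s n = inverse (real (Suc n))" for n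
  have s: "0 < s n" for n by (simp add: s_def)
  have s0: "s \<longlonglongrightarrow> 0" unfolding s_def by (rule LIMSEQ_inverse_real_of_nat)
  define F where "F n x = (LINT y|N. gauss (s n) (y - x))" for n x
  have F: "1 / ?C * (CLINT u|lborel. exp (- \<i> * (u \<bullet> x)) * \<phi> u * exp (- (s n * norm u)\<^sup>2 / 2)) = F n x" for n x
  proof -
    let ?h = "\<lambda>(u, y). iexp (u \<bullet> (y - x)) * complex_of_real (exp (- (s n * norm u)\<^sup>2 / 2))"
    have int: "integrable (lborel \<Otimes>\<^sub>M N) ?h"
    proof (rule P.Fubini_integrable)
      show "integrable lborel (\<lambda>u. LINT y|N. norm (?h (u, y)))"
        using gauss_fourier_scaled(1)[OF s] by (simp add: norm_mult N.prob_space)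
      show "AE u in lborel. integrable N (\<lambda>y. ?h (u, y))"
        by (intro AE_I2 N.integrable_const_bound[where B=1]) (auto simp: norm_mult)
    qed measurable
    have "(CLINT u|lborel. exp (- \<i> * (u \<bullet> x)) * \<phi> u * exp (- (s n * norm u)\<^sup>2 / 2)) =
        (CLINT u|lborel. CLINT y|N. ?h (u, y))"
    proof (rule Bochner_Integration.integral_cong[OF refl])
      fix u :: 'a
      have "(CLINT y|N. ?h (u, y)) =
          (CLINT y|N. exp (- \<i> * (u \<bullet> x)) * complex_of_real (exp (- (s n * norm u)\<^sup>2 / 2)) * iexp (u \<bullet> y))"
      proof (intro Bochner_Integration.integral_cong refl)
        fix y
        have "iexp (u \<bullet> (y - x)) = exp (- \<i> * (u \<bullet> x)) * iexp (u \<bullet> y)"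
          by (simp add: exp_add[symmetric] inner_diff_right right_diff_distrib)
        then show "?h (u, y) = exp (- \<i> * (u \<bullet> x)) * complex_of_real (exp (- (s n * norm u)\<^sup>2 / 2)) * iexp (u \<bullet> y)"
          by (simp only: case_prod_conv mult_ac)
      qed
      also have "\<dots> = exp (- \<i> * (u \<bullet> x)) * \<phi> u * exp (- (s n * norm u)\<^sup>2 / 2)"
        by (simp add: char mult_ac)
      finally show "exp (- \<i> * (u \<bullet> x)) * \<phi> u * exp (- (s n * norm u)\<^sup>2 / 2) = (CLINT y|N. ?h (u, y))" ..
    qed
    also have "\<dots> = (CLINT y|N. CLINT u|lborel. ?h (u, y))"
      using P.Fubini_integral[of "\<lambda>u y. ?h (u, y)"] int by simp
    also have "\<dots> = (CLINT y|N. complex_of_real (?C * gauss (s n) (y - x)))"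
      by (simp only: case_prod_conv gauss_fourier_scaled(2)[OF s] of_real_mult)
    also have "\<dots> = complex_of_real (?C * F n x)"
      unfolding F_def by (subst integral_complex_of_real) simp
    finally show ?thesis by simp
  qed
  have lim: "(\<lambda>n. complex_of_real (F n x)) \<longlonglongrightarrow> f x" for x
    unfolding F[symmetric] f_def
  proof (intro tendsto_mult_left integral_dominated_convergence)
    show "integrable lborel (\<lambda>u. \<bar>\<phi> u\<bar>)" using \<phi> by simp
    show "AE u in lborel. (\<lambda>n. exp (- \<i> * (u \<bullet> x)) * \<phi> u * exp (- (s n * norm u)\<^sup>2 / 2)) \<longlonglongrightarrow> exp (- \<i> * (u \<bullet> x)) * \<phi> u"
    proof (intro AE_I2)
      fix u :: 'a
      have "(\<lambda>n. exp (- \<i> * (u \<bullet> x)) * \<phi> u * exp (- (s n * norm u)\<^sup>2 / 2)) \<longlonglongrightarrow>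
          exp (- \<i> * (u \<bullet> x)) * \<phi> u * exp (- (0 * norm u)\<^sup>2 / 2)"
        by (intro tendsto_intros s0) auto
      then show "(\<lambda>n. exp (- \<i> * (u \<bullet> x)) * \<phi> u * exp (- (s n * norm u)\<^sup>2 / 2)) \<longlonglongrightarrow> exp (- \<i> * (u \<bullet> x)) * \<phi> u"
        by simp
    qed
    show "AE u in lborel. norm (exp (- \<i> * (u \<bullet> x)) * \<phi> u * exp (- (s n * norm u)\<^sup>2 / 2)) \<le> \<bar>\<phi> u\<bar>" for n
      by (auto simp: norm_mult intro!: mult_left_le)
  qed measurable
  then have limR: "(\<lambda>n. F n x) \<longlonglongrightarrow> Re (f x)" for x
    using tendsto_Re[OF lim] by simp
  have F0: "0 \<le> F n x" for n x
    unfolding F_def by (intro integral_nonneg_AE AE_I2 gauss_nonneg s)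
  show f0: "0 \<le> Re (f x)" for x
    by (rule LIMSEQ_le_const[OF limR]) (use F0 in auto)
  define K where "K = 1 / ?C * (LINT u|lborel. \<bar>\<phi> u\<bar>)"
  have FK: "\<bar>F n x\<bar> \<le> K" for n x
  proof -
    have "norm (complex_of_real (F n x)) \<le> K"
      unfolding F[symmetric] K_def norm_mult
    proof (intro mult_mono)
      show "norm (CLINT u|lborel. exp (- \<i> * (u \<bullet> x)) * \<phi> u * exp (- (s n * norm u)\<^sup>2 / 2)) \<le> (LINT u|lborel. \<bar>\<phi> u\<bar>)"
        by (rule Bochner_Integration.integral_norm_bound_integral)
           (use \<phi> in \<open>auto simp: norm_mult intro!: AE_I2 mult_left_le Bochner_Integration.integrable_bound[OF \<phi>]\<close>)
    qed (auto simp: norm_divide norm_power norm_mult)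
    then show ?thesis by simp
  qed
  have [measurable]: "f \<in> borel_measurable borel"
    unfolding f_def by measurable
  have [measurable]: "F n \<in> borel_measurable borel" for n
    unfolding F_def[abs_def] by measurable
  have test: "(LINT x|lborel. g x * Re (f x)) = (LINT y|N. g y)" "integrable lborel (\<lambda>x. g x * Re (f x))"
    if g: "continuous_on UNIV g" "\<And>x. 0 \<le> g x" "\<And>x. g x \<le> 1" "integrable lborel g" for g :: "'a \<Rightarrow> real"
  proof -
    have [measurable]: "g \<in> borel_measurable borel"
      using g(1) by (rule borel_measurable_continuous_onI)
    have abs_g: "\<bar>g x\<bar> \<le> 1" for x using g(2,3)[of x] by simp
    have gK: "\<bar>g x\<bar> * \<bar>r\<bar> \<le> g x * K" if "\<bar>r\<bar> \<le> K" for x r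
      using that g(2)[of x] by (simp add: mult_left_mono)
    have fK: "\<bar>Re (f x)\<bar> \<le> K" for x
      by (rule LIMSEQ_le_const2[OF tendsto_rabs[OF limR]]) (use FK in auto)
    have iK: "integrable lborel (\<lambda>x. g x * K)" using g(4) by simp
    show "integrable lborel (\<lambda>x. g x * Re (f x))"
      by (rule Bochner_Integration.integrable_bound[OF iK]) (measurable, intro AE_I2, use order_trans[OF gK[OF fK] abs_ge_self] in \<open>simp add: abs_mult\<close>)
    have "(\<lambda>n. LINT x|lborel. g x * F n x) \<longlonglongrightarrow> (LINT x|lborel. g x * Re (f x))"
    proof (rule integral_dominated_convergence)
      show "integrable lborel (\<lambda>x. g x * K)" by (rule iK)
      show "AE x in lborel. (\<lambda>n. g x * F n x) \<longlonglongrightarrow> g x * Re (f x)"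
        by (intro AE_I2 tendsto_intros limR)
      show "AE x in lborel. norm (g x * F n x) \<le> g x * K" for n
        by (intro AE_I2) (simp add: abs_mult gK[OF FK])
    qed measurable
    moreover have "(LINT x|lborel. g x * F n x) = (LINT y|N. LINT z|lborel. g (y + s n *\<^sub>R z) * gauss 1 z)" for n
    proof -
      have sub: "integrable lborel (\<lambda>x. g x * gauss (s n) (y - x))"
          "(LINT x|lborel. g x * gauss (s n) (y - x)) = (LINT z|lborel. g (y + s n *\<^sub>R z) * gauss 1 z)" for y
      proof -
        have *: "gauss (s n) (- (s n *\<^sub>R z)) = gauss 1 z / s n ^ DIM('a)" for z :: 'a
          using gauss_scaleR[OF s, of n "z"] by (simp add: gauss_def)
        have i: "integrable lborel (\<lambda>z. g (y + s n *\<^sub>R z) * gauss 1 z)"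
          by (rule Bochner_Integration.integrable_bound[OF gauss_integral(1)])
             (use abs_g in \<open>auto simp: abs_mult intro!: AE_I2 mult_left_le_one_le\<close>)
        show "integrable lborel (\<lambda>x. g x * gauss (s n) (y - x))"
          using s[of n] i by (subst lborel_scale(1)[of "s n" _ y]) (auto simp: *)
        show "(LINT x|lborel. g x * gauss (s n) (y - x)) = (LINT z|lborel. g (y + s n *\<^sub>R z) * gauss 1 z)"
          using s[of n] by (subst lborel_scale(2)[of "s n" _ y]) (auto simp: *)
      qed
      have bd: "\<bar>LINT x|lborel. g x * gauss (s n) (y - x)\<bar> \<le> 1" for y
      proof -
        have "\<bar>LINT z|lborel. g (y + s n *\<^sub>R z) * gauss 1 z\<bar> \<le> (LINT z|lborel. gauss 1 (z::'a))"
          unfolding real_norm_def[symmetric]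
          by (rule Bochner_Integration.integral_norm_bound_integral)
             (use abs_g gauss_integral(1) in \<open>auto simp: abs_mult gauss_nonneg intro!: AE_I2 mult_left_le_one_le Bochner_Integration.integrable_bound[OF gauss_integral(1)]\<close>)
        then show ?thesis by (simp add: sub gauss_integral)
      qed
      have int: "integrable (N \<Otimes>\<^sub>M lborel) (\<lambda>(y, x). g x * gauss (s n) (y - x))"
      proof (rule Q.Fubini_integrable)
        have "norm (g x * gauss (s n) (y - x)) = g x * gauss (s n) (y - x)" for x y
          using g(2)[of x] gauss_nonneg[OF s, of n "y - x"] by simp
        then show "integrable N (\<lambda>y. LINT x|lborel. norm (case (y, x) of (y, x) \<Rightarrow> g x * gauss (s n) (y - x)))"
          by (simp add: case_prod_unfold) (rule N.integrable_const_bound[where B=1], use bd in auto)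
        show "AE y in N. integrable lborel (\<lambda>x. case (y, x) of (y, x) \<Rightarrow> g x * gauss (s n) (y - x))"
          by (simp add: sub)
      qed measurable
      have "(LINT x|lborel. g x * F n x) = (LINT x|lborel. LINT y|N. g x * gauss (s n) (y - x))"
        by (simp add: F_def)
      also have "\<dots> = (LINT y|N. LINT x|lborel. g x * gauss (s n) (y - x))"
        by (rule Q.Fubini_integral[OF int])
      finally show ?thesis by (simp add: sub)
    qed
    moreover have "(\<lambda>n. LINT y|N. LINT z|lborel. g (y + s n *\<^sub>R z) * gauss 1 z) \<longlonglongrightarrow> (LINT y|N. g y)"
    proof (rule integral_dominated_convergence)
      show "AE y in N. (\<lambda>n. LINT z|lborel. g (y + s n *\<^sub>R z) * gauss 1 z) \<longlonglongrightarrow> g y"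
      proof (intro AE_I2)
        fix y
        have "(\<lambda>n. LINT z|lborel. g (y + s n *\<^sub>R z) * gauss 1 z) \<longlonglongrightarrow> (LINT z|lborel. g y * gauss 1 (z::'a))"
        proof (rule integral_dominated_convergence)
          show "AE z in lborel. (\<lambda>n. g (y + s n *\<^sub>R z) * gauss 1 z) \<longlonglongrightarrow> g y * gauss 1 z"
          proof (intro AE_I2 tendsto_intros)
            fix z :: 'a
            have "(\<lambda>n. y + s n *\<^sub>R z) \<longlonglongrightarrow> y + 0 *\<^sub>R z" by (intro tendsto_intros s0)
            then show "(\<lambda>n. g (y + s n *\<^sub>R z)) \<longlonglongrightarrow> g y"
              using g(1) by (intro continuous_on_tendsto_compose[of UNIV g]) auto
          qed
          show "integrable lborel (gauss 1 :: 'a \<Rightarrow> real)" by (rule gauss_integral)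
          show "AE z in lborel. norm (g (y + s n *\<^sub>R z) * gauss 1 z) \<le> gauss 1 z" for n
            using abs_g by (auto simp: abs_mult gauss_nonneg intro!: AE_I2 mult_left_le_one_le)
        qed measurable
        then show "(\<lambda>n. LINT z|lborel. g (y + s n *\<^sub>R z) * gauss 1 z) \<longlonglongrightarrow> g y"
          by (simp add: gauss_integral)
      qed
      show "integrable N (\<lambda>_. 1 :: real)" by simp
      show "AE y in N. norm (LINT z|lborel. g (y + s n *\<^sub>R z) * gauss 1 z) \<le> 1" for n
      proof (intro AE_I2)
        fix y
        have "norm (LINT z|lborel. g (y + s n *\<^sub>R z) * gauss 1 z) \<le> (LINT z|lborel. gauss 1 (z::'a))"
          by (rule Bochner_Integration.integral_norm_bound_integral)
             (use abs_g gauss_integral(1) in \<open>auto simp: abs_mult gauss_nonneg intro!: AE_I2 mult_left_le_one_le Bochner_Integration.integrable_bound[OF gauss_integral(1)]\<close>)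
        then show "norm (LINT z|lborel. g (y + s n *\<^sub>R z) * gauss 1 z) \<le> 1"
          by (simp add: gauss_integral)
      qed
    qed measurable
    ultimately show "(LINT x|lborel. g x * Re (f x)) = (LINT y|N. g y)"
      by (simp add: LIMSEQ_unique)
  qed
  show "N = density lborel (\<lambda>x. ennreal (Re (f x)))"
  proof (rule measure_eqI_generator_eq)
    let ?E = "range (\<lambda>(a, b). box a b::'a set)"
    let ?A = "\<lambda>n::nat. box (- (real n *\<^sub>R One)) (real n *\<^sub>R One) :: 'a set"
    show "Int_stable ?E"
      by (auto simp: Int_stable_def box_Int_box)
    show "?E \<subseteq> Pow UNIV" "sets N = sigma_sets UNIV ?E"
        "sets (density lborel (\<lambda>x. ennreal (Re (f x)))) = sigma_sets UNIV ?E"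
      by (simp_all add: borel_eq_box sets)
    show "range ?A \<subseteq> ?E" "(\<Union>i. ?A i) = UNIV"
      unfolding UN_box_eq_UNIV by auto
    show "emeasure N (?A i) \<noteq> \<infinity>" for i by simp
    fix X assume "X \<in> ?E"
    then obtain a b where X: "X = box a b" by auto
    have [measurable]: "X \<in> sets borel" by (simp add: X)
    define g where "g n x = min 1 (real n * infdist x (- X))" for n x
    have iX: "integrable lborel (indicator X :: 'a \<Rightarrow> real)"
      by (simp add: X integrable_indicator_iff emeasure_lborel_box_eq)
    have ne: "- X \<noteq> {}" using bounded_box[of a b] not_bounded_UNIV[where 'a='a] X by (metis Compl_empty_eq double_complement)
    have cl: "closed (- X)" by (simp add: X open_box closed_Compl)
    have g01: "0 \<le> g n x" "g n x \<le> 1" for n x by (auto simp: g_def infdist_nonneg)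
    have gX: "g n x \<le> indicator X x" for n x
      by (auto simp: g_def indicator_def)
    have gc: "continuous_on UNIV (g n)" for n
      unfolding g_def by (intro continuous_intros)
    have [measurable]: "g n \<in> borel_measurable borel" for n
      by (rule borel_measurable_continuous_onI[OF gc])
    have glim: "(\<lambda>n. g n x) \<longlonglongrightarrow> indicator X x" for x
    proof (cases "x \<in> X")
      case True
      then have "infdist x (- X) > 0"
        using infdist_pos_not_in_closed[OF cl ne] by auto
      then obtain n0 where n0: "1 < real n0 * infdist x (- X)" using reals_Archimedean3 by metis
      have "g n x = 1" if "n \<ge> n0" for n
      proof -
        have "real n0 * infdist x (- X) \<le> real n * infdist x (- X)"
          using that by (intro mult_right_mono infdist_nonneg) auto
        with n0 show ?thesis by (simp add: g_def)
      qed
      then have "\<forall>\<^sub>F n in sequentially. g n x = 1" by (auto simp: eventually_sequentially)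
      then show ?thesis using True by (simp add: tendsto_eventually)
    next
      case False
      then show ?thesis by (simp add: g_def)
    qed
    have gi: "integrable lborel (g n)" for n
      by (rule Bochner_Integration.integrable_bound[OF iX]) (use g01 gX in \<open>auto intro!: AE_I2\<close>)
    have fK: "\<bar>Re (f x)\<bar> \<le> K" for x
      by (rule LIMSEQ_le_const2[OF tendsto_rabs[OF limR]]) (use FK in auto)
    have iXK: "integrable lborel (\<lambda>x. indicator X x * K)" using iX by simp
    have iXf: "integrable lborel (\<lambda>x. indicator X x * Re (f x))"
      by (rule Bochner_Integration.integrable_bound[OF iXK])
         (use order_trans[OF fK abs_ge_self] in \<open>auto intro!: AE_I2 simp: indicator_def\<close>)
    have "(\<lambda>n. LINT x|lborel. g n x * Re (f x)) \<longlonglongrightarrow> (LINT x|lborel. indicator X x * Re (f x))"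
    proof (rule integral_dominated_convergence[OF _ _ iXf])
      show "AE x in lborel. norm (g n x * Re (f x)) \<le> indicator X x * Re (f x)" for n
        using g01 gX f0 by (intro AE_I2) (simp add: abs_mult mult_right_mono)
    qed (auto intro!: tendsto_intros glim)
    moreover have "(\<lambda>n. LINT y|N. g n y) \<longlonglongrightarrow> (LINT y|N. indicator X y)"
      by (rule integral_dominated_convergence[where w="\<lambda>_. 1"]) (use glim g01 in \<open>auto intro!: AE_I2\<close>)
    ultimately have "(LINT x|lborel. indicator X x * Re (f x)) = (LINT y|N. indicator X y)"
      using test(1)[OF gc g01 gi] by (simp add: LIMSEQ_unique)
    then have "measure N X = (LINT x|lborel. indicator X x * Re (f x))"
      by simp
    then have "emeasure N X = ennreal (LINT x|lborel. indicator X x * Re (f x))"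
      by (simp add: N.emeasure_eq_measure)
    also have "\<dots> = (\<integral>\<^sup>+x. ennreal (indicator X x * Re (f x)) \<partial>lborel)"
      using f0 by (intro nn_integral_eq_integral[symmetric] iXf) auto
    also have "\<dots> = emeasure (density lborel (\<lambda>x. ennreal (Re (f x)))) X"
      by (simp add: emeasure_density) (intro nn_integral_cong, auto simp: indicator_def)
    finally show "emeasure N X = emeasure (density lborel (\<lambda>x. ennreal (Re (f x)))) X" .
  qed
qed

lemma stable_density_eq_Fourier:
  fixes x y :: "'a::euclidean_space"
  shows "complex_of_real (stable_density \<alpha> t x y) =
     1 / (2 * pi) ^ DIM('a) *
         (CLINT u | lborel. exp (- \<i> * (u \<bullet> (y - x))) * exp (- t * norm u powr \<alpha>))"
proof -
  let ?h = "\<lambda>u::'a. exp (- \<i> * (u \<bullet> (y - x))) * complex_of_real (exp (- t * norm u powr \<alpha>))"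
  have "(CLINT u|lborel. ?h u) = (CLINT u|lborel. ?h (- u))"
    by (subst lborel_scale(2)[of "-1" _ 0]) simp_all
  also have "\<dots> = (CLINT u|lborel. cnj (?h u))"
    by (simp add: exp_cnj)
  finally have "cnj (CLINT u|lborel. ?h u) = (CLINT u|lborel. ?h u)"
    unfolding Bochner_Integration.integral_cnj by (rule sym)
  then have "(CLINT u|lborel. ?h u) \<in> \<real>"
    by (simp only: Reals_cnj_iff)
  then have "1 / (2 * pi) ^ DIM('a) * (CLINT u|lborel. ?h u) \<in> \<real>"
    by (intro Reals_mult) auto
  then show ?thesis
    unfolding stable_density_def by (rule of_real_Re)
qed

theorem stable_density_transition:
  fixes M :: "'b measure" and X :: "real \<Rightarrow> 'b \<Rightarrow> 'a::euclidean_space"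
  assumes M: "prob_space M"
    and X[measurable]: "\<And>t. X t \<in> borel_measurable M"
    and char: "\<And>u. (CLINT \<omega>|M. iexp (u \<bullet> (X t \<omega> - X 0 \<omega>))) = exp (- t * norm u powr \<alpha>)"
    and t: "0 < t" and \<alpha>: "0 < \<alpha>"
  shows "distributed M lborel (\<lambda>\<omega>. x + (X t \<omega> - X 0 \<omega>)) (\<lambda>y. ennreal (stable_density \<alpha> t x y))"
    and "0 \<le> stable_density \<alpha> t x y"
proof -
  interpret prob_space M by (rule M)
  define N where "N = distr M borel (\<lambda>\<omega>. X t \<omega> - X 0 \<omega>)"
  have N: "prob_space N" "sets N = sets borel"
    unfolding N_def by (auto intro!: prob_space_distr)
  have \<phi>: "(CLINT y|N. iexp (u \<bullet> y)) = complex_of_real (exp (- t * norm u powr \<alpha>))" for u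
    unfolding N_def by (subst integral_distr) (auto simp: char)
  note D = density_of_integrable_char[OF N integrable_exp_neg_norm_powr[OF t \<alpha>] \<phi>]
  have eq: "stable_density \<alpha> t x y = stable_density \<alpha> t 0 (y - x)" for x y :: 'a
    by (simp add: stable_density_def)
  show "0 \<le> stable_density \<alpha> t x y"
    using D(1)[of "y - x"] by (simp only: stable_density_def)
  have [measurable]: "stable_density \<alpha> t x \<in> borel_measurable borel" for x :: 'a
    unfolding stable_density_def[abs_def] by measurable
  have D': "N = density lborel (\<lambda>y. ennreal (stable_density \<alpha> t 0 y))"
    using D(2) by (simp only: stable_density_def diff_zero)
  have "distr M lborel (\<lambda>\<omega>. x + (X t \<omega> - X 0 \<omega>)) = distr N borel (\<lambda>y. x + y)"
    unfolding N_def by (subst distr_distr) (auto simp: comp_def intro!: distr_cong)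
  also have "\<dots> = density lborel (\<lambda>y. ennreal (stable_density \<alpha> t x y))"
  proof (rule measure_eqI)
    fix A assume "A \<in> sets (distr N borel (\<lambda>y. x + y))"
    then have [measurable]: "A \<in> sets borel" by simp
    have "emeasure (distr N borel (\<lambda>y. x + y)) A =
        (\<integral>\<^sup>+y. ennreal (stable_density \<alpha> t 0 y) * indicator A (x + y) \<partial>lborel)"
    proof -
      have "emeasure (distr N borel (\<lambda>y. x + y)) A = emeasure N ((\<lambda>y. x + y) -` A)"
        by (subst emeasure_distr) (auto simp: N_def)
      also have "\<dots> = (\<integral>\<^sup>+y. ennreal (stable_density \<alpha> t 0 y) * indicator ((\<lambda>y. x + y) -` A) y \<partial>lborel)"
        unfolding D' using measurable_sets_borel[of "\<lambda>y. x + y" borel A]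
        by (intro emeasure_density) auto
      finally show ?thesis by (simp add: indicator_vimage)
    qed
    also have "\<dots> = (\<integral>\<^sup>+y. ennreal (stable_density \<alpha> t x y) * indicator A y \<partial>distr lborel borel ((+) x))"
      by (subst nn_integral_distr) (auto simp: eq[of x])
    also have "\<dots> = emeasure (density lborel (\<lambda>y. ennreal (stable_density \<alpha> t x y))) A"
      by (simp add: lborel_distr_plus emeasure_density)
    finally show "emeasure (distr N borel (\<lambda>y. x + y)) A =
        emeasure (density lborel (\<lambda>y. ennreal (stable_density \<alpha> t x y))) A" .
  qed simp
  finally show "distributed M lborel (\<lambda>\<omega>. x + (X t \<omega> - X 0 \<omega>)) (\<lambda>y. ennreal (stable_density \<alpha> t x y))"
    by (simp add: distributed_def)
qed

end

theory Submission
  imports Defs "HOL-Complex_Analysis.Cauchy_Integral_Formula"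
begin

text \<open>
  The derivatives of order \<open>k\<close> of the density are, up to the factor \<open>1 / (2 * pi) ^ d\<close>, Fourier
  integrals of the symbols \<open>m u * exp (- t * norm u powr \<alpha>)\<close>, where \<open>m\<close> is a product of \<open>k\<close> linear
  forms.  The substitution \<open>u \<mapsto> u / r\<close> turns the symbol for time \<open>t\<close> into the one for time
  \<open>t * r powr - \<alpha>\<close>, evaluated at \<open>x / r\<close>, and brings out the factor \<open>r\<close> to the power \<open>- (d + k)\<close>.
  Two choices of \<open>r\<close> give the two halves of the minimum, for all times at once:
  \<open>r = t powr (1 / \<alpha>)\<close> reduces to time \<open>1\<close>, where the integral of the modulus of the symbol is a
  bound, and \<open>r = norm x\<close> reduces to unit vectors, where a bound that is linear in the time is
  needed (\<open>fourier_stable_symbol_unit_le\<close>).  The bounds at time \<open>1\<close> are the special case \<open>t = 1\<close>.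

  The linear bound comes from finite differences in place of integration by parts.  For a unit
  vector \<open>e\<close> and the step \<open>h = pi e\<close>, taking the difference \<open>w (u + h) - w u\<close> of a symbol multiplies
  its Fourier integral at \<open>e\<close> by \<open>-2\<close>.  So the Fourier integral is bounded by the \<open>L\<^sup>1\<close> norm of any
  iterated difference of the symbol.  Differences of order larger than \<open>k\<close> annihilate the polynomial
  \<open>m\<close>, so the exponential may be replaced by \<open>exp (- t * norm u powr \<alpha>) - 1\<close>, which is at most
  \<open>t * norm u powr \<alpha>\<close>: this is where the factor \<open>t\<close> comes from.  It remains to see that the
  differences are integrable uniformly in \<open>t\<close>.  Near the origin there is nothing to do.  Far from it,
  the restriction of the symbol to the line \<open>u + s h\<close> extends holomorphically to complex \<open>s\<close> in a
  disc of radius comparable to \<open>norm u\<close>, with the same bound up to a constant, because \<open>\<alpha> < 2\<close> keeps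
  the real part of the complexified \<open>norm u powr \<alpha>\<close> nonnegative
  (\<open>centred_symbol_holomorphic_extension\<close>).  By Cauchy's estimate every difference then gains a
  factor \<open>1 / norm u\<close>, and \<open>2 * d + k + 2\<close> of them suffice.
\<close>

section \<open>Two inequalities for complex exponentials and powers\<close>

lemma norm_exp_minus_1_le:
  fixes z :: complex
  assumes "Re z \<le> 0"
  shows "norm (exp z - 1) \<le> norm z"
proof -
  have "norm (exp z - exp 0) \<le> 1 * norm (z - 0)"
  proof (rule field_differentiable_bound[where f' = exp])
    show "convex {z. Re z \<le> 0}"
      by (rule convex_halfspace_Re_le)
  qed (use assms in \<open>auto intro: DERIV_subset[OF DERIV_exp]\<close>)
  then show ?thesis by simp
qed

lemma Re_powr_nonneg:
  assumes "0 < Re z" "0 \<le> \<gamma>" "\<gamma> \<le> 1"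
  shows "0 \<le> Re (z powr complex_of_real \<gamma>)"
proof -
  have "\<bar>\<gamma> * Im (Ln z)\<bar> \<le> 1 * (pi / 2)"
    unfolding abs_mult using Re_Ln_pos_lt_imp[OF assms(1)] assms by (intro mult_mono) auto
  then have "0 \<le> cos (\<gamma> * Im (Ln z))"
    by (intro cos_ge_zero) auto
  then show ?thesis
    using assms(1) by (auto simp: powr_def Re_exp)
qed

section \<open>Iterated forward differences\<close>

definition fwd_diff :: "'a \<Rightarrow> ('a::ab_group_add \<Rightarrow> 'b::ab_group_add) \<Rightarrow> 'a \<Rightarrow> 'b" where
  "fwd_diff h f u = f (u + h) - f u"

lemma fwd_diff_iter_Suc: "(fwd_diff h ^^ Suc N) f u = (fwd_diff h ^^ N) f (u + h) - (fwd_diff h ^^ N) f u"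
  by (simp add: fwd_diff_def)

lemma fwd_diff_iter_add:
  "(fwd_diff h ^^ N) (\<lambda>u. f u + g u) u = (fwd_diff h ^^ N) f u + (fwd_diff h ^^ N) g u"
  by (induction N arbitrary: u) (simp_all add: fwd_diff_def algebra_simps)

lemma fwd_diff_iter_norm_le:
  fixes f :: "'a::real_vector \<Rightarrow> 'b::real_normed_vector"
  assumes "\<And>j. j \<le> N \<Longrightarrow> norm (f (u + real j *\<^sub>R h)) \<le> B"
  shows "norm ((fwd_diff h ^^ N) f u) \<le> 2 ^ N * B"
  using assms
proof (induction N arbitrary: u)
  case (Suc N)
  have "norm ((fwd_diff h ^^ N) f (u + h)) \<le> 2 ^ N * B"
  proof (rule Suc.IH)
    fix j assume "j \<le> N"
    then show "norm (f (u + h + real j *\<^sub>R h)) \<le> B"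
      using Suc.prems[of "Suc j"] by (simp add: algebra_simps)
  qed
  moreover have "norm ((fwd_diff h ^^ N) f u) \<le> 2 ^ N * B"
    by (rule Suc.IH) (use Suc.prems in auto)
  ultimately show ?case
    unfolding fwd_diff_iter_Suc using norm_triangle_ineq4[of "(fwd_diff h ^^ N) f (u + h)" "(fwd_diff h ^^ N) f u"]
    by simp
qed simp

text \<open>The Leibniz rule for differences has only two terms when one factor is affine, because the second
  differences of that factor vanish.\<close>

lemma fwd_diff_iter_mult_affine:
  fixes l P :: "'a::real_vector \<Rightarrow> 'b::comm_ring_1"
  assumes l: "\<And>u. l (u + h) = l u + a"
  shows "(fwd_diff h ^^ Suc m) (\<lambda>u. l u * P u) u =
    l u * (fwd_diff h ^^ Suc m) P u + of_nat (Suc m) * a * (fwd_diff h ^^ m) P (u + h)"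
proof (induction m arbitrary: u)
  case 0
  show ?case by (simp add: fwd_diff_def l algebra_simps)
next
  case (Suc m)
  show ?case
    unfolding fwd_diff_iter_Suc[of "Suc m" h "\<lambda>u. l u * P u" u] fwd_diff_iter_Suc[of "Suc m" h P u]
      Suc l fwd_diff_iter_Suc[of m h P "u + h"]
    by (simp add: algebra_simps del: funpow.simps)
qed

text \<open>Transfers estimates for differences of holomorphic functions to functions on a vector space that
  have a holomorphic extension along the line through \<open>u\<close> in the direction of the step.\<close>

lemma fwd_diff_iter_restrict:
  fixes F :: "complex \<Rightarrow> 'b::ab_group_add" and f :: "'a::real_vector \<Rightarrow> 'b"
  assumes "\<And>s::real. F (of_real s) = f (u + s *\<^sub>R h)"
  shows "(fwd_diff h ^^ N) f (u + s *\<^sub>R h) = (fwd_diff 1 ^^ N) F (of_real s)"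
proof (induction N arbitrary: s)
  case (Suc N)
  show ?case
    unfolding fwd_diff_iter_Suc using Suc[of s] Suc[of "s + 1"] by (simp add: algebra_simps)
qed (simp add: assms)

lemma fwd_diff_iter_eq_0:
  assumes "(fwd_diff h ^^ m) f = (\<lambda>_. 0)" "m \<le> n"
  shows "(fwd_diff h ^^ n) f = (\<lambda>_. 0)"
  using assms(2,1) by (induction rule: dec_induct) (auto simp: fwd_diff_def fun_eq_iff)

text \<open>A unit step of the difference operator is controlled by the derivative on a disc of radius
  \<open>\<rho> + 1\<close>, hence by Cauchy's estimate with radius \<open>\<delta> - 1\<close>.  So each difference costs \<open>\<delta>\<close> in the radius
  of the disc and gains the factor \<open>1 / (\<delta> - 1) \<le> 2 / \<delta>\<close>.\<close>

lemma fwd_diff_iter_holomorphic_le: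
  assumes "f holomorphic_on ball 0 (\<rho> + real N * \<delta>)" "2 \<le> \<delta>"
    and "\<And>z. norm z < \<rho> + real N * \<delta> \<Longrightarrow> norm (f z) \<le> M" and "norm z < \<rho>"
  shows "norm ((fwd_diff 1 ^^ N) f z) \<le> M * (2 / \<delta>) ^ N"
  using assms
proof (induction N arbitrary: f M)
  case 0
  then show ?case by simp
next
  case (Suc N)
  let ?R = "\<rho> + real N * \<delta>"
  have R: "\<rho> + real (Suc N) * \<delta> = ?R + \<delta>" by (simp add: algebra_simps)
  note hol = Suc.prems(1)[unfolded R] and le = Suc.prems(3)[unfolded R]
  have M: "0 \<le> M"
  proof -
    have "norm z < ?R + \<delta>" 
      using Suc.prems(2,4) by (smt (verit) mult_nonneg_nonneg of_nat_0_le_iff)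
    then show ?thesis using le[of z] norm_ge_zero order_trans by blast
  qed
  have d: "norm (deriv f w) \<le> M / (\<delta> - 1)" if w: "norm w < ?R + 1" for w
  proof -
    have sub: "cball w (\<delta> - 1) \<subseteq> ball 0 (?R + \<delta>)"
    proof
      fix y assume "y \<in> cball w (\<delta> - 1)"
      then have "norm y \<le> norm w + (\<delta> - 1)"
        using norm_triangle_ineq4[of w "w - y"] by (auto simp: dist_norm)
      with w show "y \<in> ball 0 (?R + \<delta>)" by simp
    qed
    have "norm ((deriv ^^ 1) f w) \<le> fact 1 * M / (\<delta> - 1) ^ 1"
    proof (rule Cauchy_inequality)
      show "f holomorphic_on ball w (\<delta> - 1)"
        using hol sub ball_subset_cball by (meson holomorphic_on_subset order_trans)
      show "continuous_on (cball w (\<delta> - 1)) f"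
        using hol sub by (meson holomorphic_on_imp_continuous_on continuous_on_subset)
      show "norm (f x) \<le> M" if "norm (w - x) = \<delta> - 1" for x
      proof (rule le)
        have "x \<in> cball w (\<delta> - 1)" using that by (simp add: dist_norm)
        then show "norm x < ?R + \<delta>" using sub by auto
      qed
    qed (use Suc.prems(2) in auto)
    then show ?thesis by simp
  qed
  have D: "norm (fwd_diff 1 f w) \<le> M * (2 / \<delta>)" if w: "norm w < ?R" for w
  proof -
    have w1: "norm (w + 1) < ?R + 1"
      using w norm_triangle_ineq[of w 1] by simp
    have "norm (f (w + 1) - f w) \<le> M / (\<delta> - 1) * norm (w + 1 - w)"
    proof (rule field_differentiable_bound[where S = "ball 0 (?R + 1)" and f' = "deriv f"])
      show "(f has_field_derivative deriv f y) (at y within ball 0 (?R + 1))" if "y \<in> ball 0 (?R + 1)" for y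
      proof (rule has_field_derivative_at_within, rule holomorphic_derivI[OF hol])
        show "y \<in> ball 0 (?R + \<delta>)" using that Suc.prems(2) by simp
      qed simp
    qed (use d w w1 in auto)
    also have "\<dots> \<le> M * (2 / \<delta>)"
      using M Suc.prems(2) by (simp add: field_simps mult_left_mono)
    finally show ?thesis by (simp add: fwd_diff_def)
  qed
  have "fwd_diff 1 f holomorphic_on ball 0 ?R"
  proof -
    have "(\<lambda>w. f (w + 1)) holomorphic_on ball 0 ?R"
    proof (rule holomorphic_on_compose_gen[of "\<lambda>w. w + 1" _ f "ball 0 (?R + \<delta>)", unfolded comp_def])
      show "(\<lambda>w::complex. w + 1) ` ball 0 ?R \<subseteq> ball 0 (?R + \<delta>)"
      proof (intro image_subsetI)
        fix w :: complex assume "w \<in> ball 0 ?R"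
        then show "w + 1 \<in> ball 0 (?R + \<delta>)"
          using norm_triangle_ineq[of w 1] Suc.prems(2) by simp
      qed
    qed (intro holomorphic_intros, rule hol)
    moreover have "f holomorphic_on ball 0 ?R"
      by (rule holomorphic_on_subset[OF hol]) (use Suc.prems(2) in auto)
    ultimately show ?thesis
      unfolding fwd_diff_def[abs_def] by (intro holomorphic_intros)
  qed
  then have "norm ((fwd_diff 1 ^^ N) (fwd_diff 1 f) z) \<le> M * (2 / \<delta>) * (2 / \<delta>) ^ N"
    using Suc.prems(2,4) D by (intro Suc.IH) auto
  then show ?case by (simp add: funpow_swap1 mult.assoc)
qed

section \<open>Fourier integrals\<close>

text \<open>The Fourier transform with the sign and normalisation of the inversion formula, without the
  factor \<open>1 / (2 * pi) ^ d\<close>.\<close>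

definition fourier :: "('a::euclidean_space \<Rightarrow> complex) \<Rightarrow> 'a \<Rightarrow> complex" where
  "fourier w x = (CLINT u|lborel. exp (- \<i> * (u \<bullet> x)) * w u)"

lemma fourier_integrable:
  assumes "integrable lborel w"
  shows "integrable lborel (\<lambda>u::'a::euclidean_space. exp (- \<i> * (u \<bullet> x)) * w u)"
proof (rule Bochner_Integration.integrable_bound[OF assms])
  have [measurable]: "w \<in> borel_measurable borel"
    using borel_measurable_integrable[OF assms] by simp
  show "(\<lambda>u::'a. exp (- \<i> * (u \<bullet> x)) * w u) \<in> borel_measurable lborel" by measurable
qed (simp add: norm_mult)

lemma norm_fourier_le:
  assumes "integrable lborel w"
  shows "norm (fourier w x) \<le> (LINT u|lborel. norm (w u))"
  unfolding fourier_def
  by (rule Bochner_Integration.integral_norm_bound_integral[OF fourier_integrable[OF assms]])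
     (use assms in \<open>auto simp: norm_mult\<close>)

lemma fourier_scale:
  fixes w :: "'a::euclidean_space \<Rightarrow> complex"
  assumes [measurable]: "w \<in> borel_measurable borel" and r: "0 < r"
  shows "fourier w x = complex_of_real (inverse r ^ DIM('a)) * fourier (\<lambda>u. w (u /\<^sub>R r)) (x /\<^sub>R r)"
  unfolding fourier_def using r
  by (subst lborel_scale(2)[of "inverse r" _ 0]) (auto simp: scaleR_conv_of_real)

text \<open>Translation of the symbol by \<open>h\<close> multiplies the Fourier integral at \<open>x\<close> by a phase.\<close>

lemma fourier_fwd_diff:
  fixes w :: "'a::euclidean_space \<Rightarrow> complex"
  assumes w: "integrable lborel w"
  shows "integrable lborel (fwd_diff h w)"
    and "fourier (fwd_diff h w) x = (iexp (h \<bullet> x) - 1) * fourier w x"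
proof -
  have [measurable]: "w \<in> borel_measurable borel"
    using borel_measurable_integrable[OF w] by simp
  have wh: "integrable lborel (\<lambda>u. w (u + h))"
    using w lborel_scale(1)[of 1 w h] by (simp add: add.commute)
  show "integrable lborel (fwd_diff h w)"
    unfolding fwd_diff_def using w wh by (rule Bochner_Integration.integrable_diff[rotated])
  have e: "exp (- \<i> * (u \<bullet> x)) = iexp (h \<bullet> x) * exp (- \<i> * ((h + u) \<bullet> x))" for u
    by (simp add: inner_add_left exp_add[symmetric] algebra_simps)
  have "fourier (\<lambda>u. w (u + h)) x = iexp (h \<bullet> x) * (CLINT u|lborel. exp (- \<i> * ((h + u) \<bullet> x)) * w (h + u))"
    unfolding fourier_def by (subst e) (simp only: mult.assoc integral_mult_right_zero add.commute)
  also have "(CLINT u|lborel. exp (- \<i> * ((h + u) \<bullet> x)) * w (h + u)) = fourier w x"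
    unfolding fourier_def by (subst (2) lborel_scale(2)[of 1 _ h]) auto
  finally show "fourier (fwd_diff h w) x = (iexp (h \<bullet> x) - 1) * fourier w x"
    using fourier_integrable[OF w, of x] fourier_integrable[OF wh, of x]
    unfolding fourier_def fwd_diff_def
    by (simp add: right_diff_distrib left_diff_distrib)
qed

lemma fourier_fwd_diff_iter:
  fixes w :: "'a::euclidean_space \<Rightarrow> complex"
  assumes w: "integrable lborel w"
  shows "integrable lborel ((fwd_diff h ^^ N) w)"
    and "fourier ((fwd_diff h ^^ N) w) x = (iexp (h \<bullet> x) - 1) ^ N * fourier w x"
proof (induction N)
  case (Suc N)
  case 1 show ?case using fourier_fwd_diff(1)[OF Suc(1)] by simp
  case 2 show ?case using fourier_fwd_diff(2)[OF Suc(1)] Suc(2) by simp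
qed (use w in simp_all)

text \<open>Differentiation under the integral sign: the difference quotients of the exponential are
  dominated by \<open>\<bar>u \<bullet> b\<bar>\<close>, so integrability of the formal derivative is enough.\<close>

lemma fourier_difference_quotient:
  fixes w :: "'a::euclidean_space \<Rightarrow> complex"
  assumes w: "integrable lborel w"
    and wb: "integrable lborel (\<lambda>u. - \<i> * complex_of_real (u \<bullet> b) * w u)"
  shows "((\<lambda>s. (fourier w (x + s *\<^sub>R b) - fourier w x) / complex_of_real s)
    \<longlongrightarrow> fourier (\<lambda>u. - \<i> * complex_of_real (u \<bullet> b) * w u) x) (at 0)"
  unfolding tendsto_at_iff_sequentially
proof (intro allI impI)
  fix X :: "nat \<Rightarrow> real" assume "\<forall>i. X i \<in> UNIV - {0}" and X0: "X \<longlonglongrightarrow> 0"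
  then have X: "X i \<noteq> 0" for i by auto
  have [measurable]: "w \<in> borel_measurable borel"
    using borel_measurable_integrable[OF w] by simp
  define q where "q i u = (exp (- \<i> * (X i * (u \<bullet> b))) - 1) / X i" for i u
  have [measurable]: "q i \<in> borel_measurable borel" for i
    unfolding q_def[abs_def] by measurable
  have eq: "(fourier w (x + X i *\<^sub>R b) - fourier w x) / X i =
      (CLINT u|lborel. exp (- \<i> * (u \<bullet> x)) * q i u * w u)" for i
  proof -
    have "(fourier w (x + X i *\<^sub>R b) - fourier w x) / X i =
      (CLINT u|lborel. (exp (- \<i> * (u \<bullet> (x + X i *\<^sub>R b))) * w u - exp (- \<i> * (u \<bullet> x)) * w u) / X i)"
      unfolding fourier_def
      using fourier_integrable[OF w, of x] fourier_integrable[OF w, of "x + X i *\<^sub>R b"] by simp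
    also have "\<dots> = (CLINT u|lborel. exp (- \<i> * (u \<bullet> x)) * q i u * w u)"
    proof (intro Bochner_Integration.integral_cong refl)
      fix u
      have "exp (- \<i> * (u \<bullet> (x + X i *\<^sub>R b))) = exp (- \<i> * (u \<bullet> x)) * exp (- \<i> * (X i * (u \<bullet> b)))"
        by (simp add: inner_add_right exp_add[symmetric] algebra_simps)
      then show "(exp (- \<i> * (u \<bullet> (x + X i *\<^sub>R b))) * w u - exp (- \<i> * (u \<bullet> x)) * w u) / X i
          = exp (- \<i> * (u \<bullet> x)) * q i u * w u"
        unfolding q_def by (simp add: field_simps X)
    qed
    finally show ?thesis .
  qed
  have lim: "(\<lambda>i. q i u) \<longlonglongrightarrow> - \<i> * (u \<bullet> b)" for u
  proof -
    have "((\<lambda>z. exp (- \<i> * (u \<bullet> b) * z)) has_field_derivative - \<i> * (u \<bullet> b)) (at 0)"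
      by (auto intro!: derivative_eq_intros)
    then have "((\<lambda>z. (exp (- \<i> * (u \<bullet> b) * z) - 1) / z) \<longlongrightarrow> - \<i> * (u \<bullet> b)) (at 0)"
      by (simp add: DERIV_def)
    moreover have "filterlim (\<lambda>i. complex_of_real (X i)) (at 0) sequentially"
      unfolding filterlim_at using X tendsto_of_real[OF X0, where 'a=complex] by simp
    ultimately have "(\<lambda>i. (exp (- \<i> * (u \<bullet> b) * complex_of_real (X i)) - 1) / X i) \<longlonglongrightarrow> - \<i> * (u \<bullet> b)"
      by (rule filterlim_compose)
    then show ?thesis
      unfolding q_def by (simp add: mult_ac)
  qed
  have bound: "norm (q i u) \<le> norm (- \<i> * (u \<bullet> b))" for i u
    using norm_exp_minus_1_le[of "- \<i> * (X i * (u \<bullet> b))"] X[of i]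
    by (simp add: q_def norm_divide norm_mult field_simps abs_mult)
  have "(\<lambda>i. CLINT u|lborel. exp (- \<i> * (u \<bullet> x)) * q i u * w u)
     \<longlonglongrightarrow> (CLINT u|lborel. exp (- \<i> * (u \<bullet> x)) * (- \<i> * (u \<bullet> b)) * w u)"
  proof (rule integral_dominated_convergence)
    show "integrable lborel (\<lambda>u. norm (- \<i> * (u \<bullet> b) * w u))"
      using wb by (rule integrable_norm)
    show "AE u in lborel. norm (exp (- \<i> * (u \<bullet> x)) * q i u * w u) \<le> norm (- \<i> * (u \<bullet> b) * w u)" for i
      using bound by (intro AE_I2) (auto simp: norm_mult intro!: mult_right_mono)
    show "AE u in lborel. (\<lambda>i. exp (- \<i> * (u \<bullet> x)) * q i u * w u)
        \<longlonglongrightarrow> exp (- \<i> * (u \<bullet> x)) * (- \<i> * (u \<bullet> b)) * w u"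
      by (intro AE_I2 tendsto_mult tendsto_const lim)
  qed measurable
  then show "((\<lambda>s. (fourier w (x + s *\<^sub>R b) - fourier w x) / complex_of_real s) \<circ> X)
    \<longlonglongrightarrow> fourier (\<lambda>u. - \<i> * complex_of_real (u \<bullet> b) * w u) x"
    by (simp only: comp_def eq) (simp only: fourier_def mult.assoc)
qed

section \<open>The symbols of the density and its derivatives\<close>

text \<open>The symbol of the differential operator that \<open>partials bs\<close> applies.\<close>

definition monom_symbol :: "'a::euclidean_space list \<Rightarrow> 'a \<Rightarrow> complex" where
  "monom_symbol bs u = (\<Prod>b\<leftarrow>bs. - \<i> * complex_of_real (u \<bullet> b))"

definition stable_symbol :: "real \<Rightarrow> real \<Rightarrow> 'a::euclidean_space list \<Rightarrow> 'a \<Rightarrow> complex" where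
  "stable_symbol \<alpha> t bs u = monom_symbol bs u * complex_of_real (exp (- t * norm u powr \<alpha>))"

lemma monom_symbol_simps [simp]:
  "monom_symbol [] u = 1"
  "monom_symbol (b # bs) u = - \<i> * complex_of_real (u \<bullet> b) * monom_symbol bs u"
  by (simp_all add: monom_symbol_def)

lemma measurable_monom_symbol [measurable]: "monom_symbol bs \<in> borel_measurable borel"
  by (induction bs) (simp_all add: monom_symbol_def[abs_def])

lemma measurable_stable_symbol [measurable]: "stable_symbol \<alpha> t bs \<in> borel_measurable borel"
  unfolding stable_symbol_def[abs_def] by measurable

lemma norm_monom_symbol_le:
  assumes "set bs \<subseteq> Basis"
  shows "norm (monom_symbol bs u) \<le> norm u ^ length bs"
  using assms by (induction bs) (auto simp: norm_mult Basis_le_norm intro!: mult_mono)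

lemma monom_symbol_scaleR: "monom_symbol bs (c *\<^sub>R u) = complex_of_real (c ^ length bs) * monom_symbol bs u"
  by (induction bs) (auto simp: mult_ac)

lemma power_mult_exp_neg_powr_bounded:
  fixes \<alpha> t :: real
  assumes "0 < \<alpha>" "0 < t"
  shows "\<exists>K. \<forall>r\<ge>0. r ^ k * exp (- t * r powr \<alpha>) \<le> K * exp (- (t / 2) * r powr \<alpha>)"
proof -
  have "((\<lambda>r. r powr real k * exp (- (t / 2) * r powr \<alpha>)) \<longlongrightarrow> 0) at_top"
    using assms by real_asymp
  then have "\<forall>\<^sub>F r in at_top. r powr real k * exp (- (t / 2) * r powr \<alpha>) < 1"
    by (rule order_tendstoD) simp
  then obtain N where N0: "\<And>r. N \<le> r \<Longrightarrow> r powr real k * exp (- (t / 2) * r powr \<alpha>) < 1"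
    by (auto simp: eventually_at_top_linorder)
  then have N: "r ^ k * exp (- (t / 2) * r powr \<alpha>) < 1" if "N \<le> r" "0 < r" for r
    using N0[OF that(1)] that(2) by (simp add: powr_realpow)
  have "r ^ k * exp (- t * r powr \<alpha>) \<le> (1 + \<bar>N\<bar> ^ k) * exp (- (t / 2) * r powr \<alpha>)" if r: "0 \<le> r" for r
  proof -
    have "r ^ k * exp (- (t / 2) * r powr \<alpha>) \<le> 1 + \<bar>N\<bar> ^ k"
    proof (cases "N \<le> r \<and> 0 < r")
      case True
      then show ?thesis using N[of r] by (smt (verit) zero_le_power abs_ge_zero)
    next
      case False
      then have "r ^ k \<le> \<bar>N\<bar> ^ k" using r by (intro power_mono) auto
      moreover have "exp (- (t / 2) * r powr \<alpha>) \<le> 1" using assms by simp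
      ultimately have "r ^ k * exp (- (t / 2) * r powr \<alpha>) \<le> \<bar>N\<bar> ^ k * 1"
        by (intro mult_mono) auto
      then show ?thesis by simp
    qed
    moreover have "exp (- t * r powr \<alpha>) = exp (- (t / 2) * r powr \<alpha>) * exp (- (t / 2) * r powr \<alpha>)"
      by (simp add: exp_add[symmetric])
    ultimately show ?thesis
      by (simp only: mult.assoc[symmetric]) (intro mult_right_mono, auto)
  qed
  then show ?thesis by blast
qed

lemma integrable_power_mult_exp_neg_norm_powr:
  fixes \<alpha> t :: real
  assumes "0 < \<alpha>" "0 < t"
  shows "integrable lborel (\<lambda>u::'a::euclidean_space. norm u ^ k * exp (- t * norm u powr \<alpha>))"
proof -
  obtain K where K: "\<And>r. 0 \<le> r \<Longrightarrow> r ^ k * exp (- t * r powr \<alpha>) \<le> K * exp (- (t / 2) * r powr \<alpha>)"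
    using power_mult_exp_neg_powr_bounded[OF assms] by blast
  have "integrable lborel (\<lambda>u::'a. K * exp (- (t / 2) * norm u powr \<alpha>))"
    using assms by (intro integrable_mult_right integrable_exp_neg_norm_powr) auto
  then show ?thesis
  proof (rule Bochner_Integration.integrable_bound)
    show "AE u::'a in lborel. norm (norm u ^ k * exp (- t * norm u powr \<alpha>))
        \<le> norm (K * exp (- (t / 2) * norm u powr \<alpha>))"
      using order_trans[OF K abs_ge_self] by (intro AE_I2) simp
  qed measurable
qed

lemma norm_stable_symbol_le:
  assumes "set bs \<subseteq> Basis"
  shows "norm (stable_symbol \<alpha> t bs u) \<le> norm u ^ length bs * exp (- t * norm u powr \<alpha>)"
  unfolding stable_symbol_def norm_mult
  using norm_monom_symbol_le[OF assms, of u] by (simp add: mult_right_mono)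

lemma integrable_stable_symbol:
  fixes bs :: "'a::euclidean_space list"
  assumes "0 < \<alpha>" "0 < t" "set bs \<subseteq> Basis"
  shows "integrable lborel (stable_symbol \<alpha> t bs)"
proof (rule Bochner_Integration.integrable_bound[OF integrable_power_mult_exp_neg_norm_powr[OF assms(1,2)]])
  show "AE u in lborel. norm (stable_symbol \<alpha> t bs u)
      \<le> norm (norm u ^ length bs * exp (- t * norm u powr \<alpha>))"
    using norm_stable_symbol_le[OF assms(3), of \<alpha> t] by (intro AE_I2) simp
qed simp

text \<open>Self-similarity of the stable process, for the density and all its derivatives.\<close>

lemma fourier_stable_symbol_scale:
  fixes bs :: "'a::euclidean_space list"
  assumes r: "0 < r"
  shows "fourier (stable_symbol \<alpha> t bs) x = complex_of_real (inverse r ^ (DIM('a) + length bs)) *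
    fourier (stable_symbol \<alpha> (t * r powr - \<alpha>) bs) (x /\<^sub>R r)"
proof -
  have "stable_symbol \<alpha> t bs (u /\<^sub>R r) =
      complex_of_real (inverse r ^ length bs) * stable_symbol \<alpha> (t * r powr - \<alpha>) bs u" for u :: 'a
    using r by (simp add: stable_symbol_def monom_symbol_scaleR powr_mult powr_minus inverse_powr mult_ac)
  then have "fourier (\<lambda>u. stable_symbol \<alpha> t bs (u /\<^sub>R r)) (x /\<^sub>R r) =
    complex_of_real (inverse r ^ length bs) * fourier (stable_symbol \<alpha> (t * r powr - \<alpha>) bs) (x /\<^sub>R r)"
    unfolding fourier_def by (simp add: mult.left_commute)
  then show ?thesis
    by (subst fourier_scale[OF _ r]) (auto simp: power_add)
qed

text \<open>A derivative in a coordinate direction multiplies the symbol by one more linear form, and the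
  exponential keeps the product integrable, so differentiation under the integral sign can be
  repeated.\<close>

lemma stable_density_partials:
  fixes bs :: "'a::euclidean_space list"
  assumes \<alpha>: "0 < \<alpha>" and t: "0 < t" and "set bs \<subseteq> Basis"
  shows "partials bs (stable_density \<alpha> t 0) = (\<lambda>x. Re (fourier (stable_symbol \<alpha> t bs) x) / (2 * pi) ^ DIM('a))"
    and "partials_exist bs (stable_density \<alpha> t 0) x"
proof -
  let ?P = "\<lambda>bs x::'a. Re (fourier (stable_symbol \<alpha> t bs) x) / (2 * pi) ^ DIM('a)"
  have der: "((\<lambda>s. ?P bs (x + s *\<^sub>R b)) has_real_derivative ?P (b # bs) x) (at 0)"
    if "set (b # bs) \<subseteq> Basis" for b bs x
  proof -
    have eq: "stable_symbol \<alpha> t (b # bs) = (\<lambda>u. - \<i> * complex_of_real (u \<bullet> b) * stable_symbol \<alpha> t bs u)"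
      by (simp add: stable_symbol_def fun_eq_iff)
    have "((\<lambda>s. (fourier (stable_symbol \<alpha> t bs) (x + s *\<^sub>R b) - fourier (stable_symbol \<alpha> t bs) x) / complex_of_real s)
      \<longlongrightarrow> fourier (stable_symbol \<alpha> t (b # bs)) x) (at 0)"
      unfolding eq using that integrable_stable_symbol[OF \<alpha> t, of bs] integrable_stable_symbol[OF \<alpha> t that]
      by (intro fourier_difference_quotient) (auto simp: eq)
    then have "((\<lambda>s. Re ((fourier (stable_symbol \<alpha> t bs) (x + s *\<^sub>R b) - fourier (stable_symbol \<alpha> t bs) x) / complex_of_real s) / (2 * pi) ^ DIM('a))
      \<longlongrightarrow> ?P (b # bs) x) (at 0)"
      by (intro tendsto_intros) auto
    then show ?thesis
      by (simp add: DERIV_def diff_divide_distrib mult_ac)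
  qed
  have *: "partials bs (stable_density \<alpha> t 0) = ?P bs" if "set bs \<subseteq> Basis" for bs :: "'a list"
    using that
  proof (induction bs)
    case Nil
    show ?case
    proof
      fix x :: 'a
      have "stable_density \<alpha> t 0 x = Re (complex_of_real (1 / (2 * pi) ^ DIM('a)) * fourier (stable_symbol \<alpha> t []) x)"
        by (simp add: stable_density_def fourier_def stable_symbol_def)
      then show "partials [] (stable_density \<alpha> t 0) x = ?P [] x"
        by (simp only: times_complex.sel Re_complex_of_real Im_complex_of_real) simp
    qed
  next
    case (Cons b bs)
    then show ?case
      using DERIV_imp_deriv[OF der[OF Cons.prems]] by (simp add: partial_def[abs_def])
  qed
  then show "partials bs (stable_density \<alpha> t 0) = ?P bs"
    using assms(3) .
  have "partials_exist bs (stable_density \<alpha> t 0) x" if "set bs \<subseteq> Basis" for bs :: "'a list" and x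
    using that
  proof (induction bs arbitrary: x)
    case (Cons b bs)
    have "(\<lambda>s. partials bs (stable_density \<alpha> t 0) (x + s *\<^sub>R b)) differentiable (at 0)"
      using der[OF Cons.prems, of x] Cons.prems
      by (subst *) (auto simp: real_differentiable_def)
    with Cons show ?case by (simp add: always_eventually)
  qed simp
  then show "partials_exist bs (stable_density \<alpha> t 0) x"
    using assms(3) .
qed

section \<open>Differences of the symbol\<close>

lemma fwd_diff_iter_monom_symbol:
  "(fwd_diff h ^^ Suc (length bs)) (monom_symbol bs) = (\<lambda>_. 0)"
proof (induction bs)
  case Nil
  show ?case by (simp add: fwd_diff_def monom_symbol_def fun_eq_iff)
next
  case (Cons b bs)
  let ?l = "\<lambda>u. - \<i> * complex_of_real (u \<bullet> b)"
  have l: "\<And>u. ?l (u + h) = ?l u + ?l h"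
    by (simp add: inner_add_left algebra_simps)
  have "monom_symbol (b # bs) = (\<lambda>u. ?l u * monom_symbol bs u)"
    by (simp add: fun_eq_iff)
  then show ?case
    using fwd_diff_iter_eq_0[OF Cons.IH le_SucI[OF order_refl]] Cons.IH
    by (simp only: fwd_diff_iter_mult_affine[of ?l, OF l] list.size add_0_right add_Suc_right mult_zero_right add_0)
qed

text \<open>The stable symbol minus its polynomial part, which differences of high order do not see.  What is
  left vanishes at the origin to the order \<open>k + \<alpha>\<close> and is of the first order in \<open>t\<close>.\<close>

definition centred_symbol :: "real \<Rightarrow> real \<Rightarrow> 'a::euclidean_space list \<Rightarrow> 'a \<Rightarrow> complex" where
  "centred_symbol \<alpha> t bs u = monom_symbol bs u * complex_of_real (exp (- t * norm u powr \<alpha>) - 1)"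

lemma fwd_diff_iter_stable_symbol:
  assumes "length bs < N"
  shows "(fwd_diff h ^^ N) (stable_symbol \<alpha> t bs) = (fwd_diff h ^^ N) (centred_symbol \<alpha> t bs)"
proof -
  have eq: "stable_symbol \<alpha> t bs = (\<lambda>u. monom_symbol bs u + centred_symbol \<alpha> t bs u)"
    by (simp add: fun_eq_iff stable_symbol_def centred_symbol_def algebra_simps)
  show ?thesis
    by (intro ext) (simp only: eq fwd_diff_iter_add add_0
      fwd_diff_iter_eq_0[OF fwd_diff_iter_monom_symbol Suc_leI[OF assms]])
qed

lemma norm_centred_symbol_le:
  assumes "set bs \<subseteq> Basis" "0 \<le> t"
  shows "norm (centred_symbol \<alpha> t bs u) \<le> t * norm u ^ length bs * norm u powr \<alpha>"
proof -
  have "norm (complex_of_real (exp (- t * norm u powr \<alpha>) - 1)) \<le> t * norm u powr \<alpha>"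
    using norm_exp_minus_1_le[of "complex_of_real (- t * norm u powr \<alpha>)"] assms(2)
    by (simp flip: exp_of_real add: abs_mult norm_mult)
  then show ?thesis
    unfolding centred_symbol_def norm_mult using norm_monom_symbol_le[OF assms(1), of u] assms(2)
    by (subst mult.assoc, subst mult.left_commute) (intro mult_mono, auto)
qed

text \<open>The square \<open>(norm (u + s *\<^sub>R h))\<^sup>2\<close> is a quadratic polynomial \<open>q\<close> in \<open>s\<close>.  For complex \<open>s\<close> in a disc
  of radius \<open>norm u / (8 * norm h)\<close> it stays within \<open>(norm u)\<^sup>2 / 2\<close> of \<open>(norm u)\<^sup>2\<close>, in particular in the
  right half plane.  There the principal power \<open>q powr (\<alpha> / 2)\<close> is holomorphic, and since \<open>\<alpha> / 2 < 1\<close>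
  it has nonnegative real part, so the exponential does not grow.\<close>

lemma centred_symbol_holomorphic_extension:
  fixes u h :: "'a::euclidean_space"
  assumes \<alpha>: "0 < \<alpha>" "\<alpha> < 2" and t: "0 \<le> t" and bs: "set bs \<subseteq> Basis" and h: "h \<noteq> 0" and u: "u \<noteq> 0"
  defines "R \<equiv> norm u / (8 * norm h)"
  obtains F where "F holomorphic_on ball 0 R"
    and "\<And>s::real. F (of_real s) = centred_symbol \<alpha> t bs (u + s *\<^sub>R h)"
    and "\<And>z. norm z < R \<Longrightarrow> norm (F z) \<le> 2 ^ (length bs + 1) * t * norm u ^ length bs * norm u powr \<alpha>"
proof -
  define q where "q z = complex_of_real ((norm u)\<^sup>2) + 2 * z * complex_of_real (u \<bullet> h) + z\<^sup>2 * complex_of_real ((norm h)\<^sup>2)" for z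
  define m where "m z = (\<Prod>b\<leftarrow>bs. - \<i> * (complex_of_real (u \<bullet> b) + z * complex_of_real (h \<bullet> b)))" for z
  define F where "F z = m z * (exp (- complex_of_real t * q z powr complex_of_real (\<alpha> / 2)) - 1)" for z
  have q_near: "norm (q z - complex_of_real ((norm u)\<^sup>2)) \<le> (norm u)\<^sup>2 / 2" if z: "norm z < R" for z
  proof -
    have zh: "norm z * norm h \<le> norm u / 8"
      using z h by (simp add: R_def field_simps)
    have "norm (q z - complex_of_real ((norm u)\<^sup>2)) \<le> norm (2 * z * complex_of_real (u \<bullet> h)) + norm (z\<^sup>2 * complex_of_real ((norm h)\<^sup>2))"
      unfolding q_def by (rule order_trans[OF _ norm_triangle_ineq]) simp
    also have "\<dots> \<le> 2 * (norm z * norm h) * norm u + (norm z * norm h)\<^sup>2"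
      using mult_left_mono[OF Cauchy_Schwarz_ineq2[of u h] norm_ge_zero[of z]]
      by (simp add: norm_mult norm_power power_mult_distrib mult_ac)
    also have "\<dots> \<le> 2 * (norm u / 8) * norm u + (norm u / 8)\<^sup>2"
      using zh by (intro add_mono mult_mono power_mono) auto
    also have "\<dots> \<le> (norm u)\<^sup>2 / 2"
      by (simp add: power2_eq_square)
    finally show ?thesis .
  qed
  have q_pos: "0 < Re (q z)" and q_le: "norm (q z) \<le> 2 * (norm u)\<^sup>2" if z: "norm z < R" for z
  proof -
    have "Re (q z - complex_of_real ((norm u)\<^sup>2)) = Re (q z) - (norm u)\<^sup>2"
      by simp
    moreover have "\<bar>Re (q z - complex_of_real ((norm u)\<^sup>2))\<bar> \<le> (norm u)\<^sup>2 / 2"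
      using q_near[OF z] abs_Re_le_cmod order_trans by blast
    moreover have "0 < (norm u)\<^sup>2" using u by simp
    ultimately show "0 < Re (q z)" by linarith
    show "norm (q z) \<le> 2 * (norm u)\<^sup>2"
      using q_near[OF z] norm_triangle_sub[of "q z" "complex_of_real ((norm u)\<^sup>2)"] zero_le_power2[of "norm u"]
      by (simp only: norm_of_real abs_power2)
  qed
  show thesis
  proof
    have "q z \<notin> \<real>\<^sub>\<le>\<^sub>0" if "norm z < R" for z
      using q_pos[OF that] by (auto simp: complex_nonpos_Reals_iff)
    moreover have "q holomorphic_on A" for A
      unfolding q_def[abs_def] by (intro holomorphic_intros)
    moreover have "m holomorphic_on A" for A
      unfolding m_def[abs_def] by (induction bs) (auto intro!: holomorphic_intros)
    ultimately show "F holomorphic_on ball 0 R"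
      unfolding F_def[abs_def] by (intro holomorphic_intros) auto
    show "F (of_real s) = centred_symbol \<alpha> t bs (u + s *\<^sub>R h)" for s
    proof -
      have "q (of_real s) = complex_of_real ((norm (u + s *\<^sub>R h))\<^sup>2)"
        unfolding q_def power2_norm_eq_inner
        by (simp add: inner_add_left inner_add_right inner_commute power2_eq_square algebra_simps)
      then have "q (of_real s) powr complex_of_real (\<alpha> / 2) = complex_of_real (((norm (u + s *\<^sub>R h))\<^sup>2) powr (\<alpha> / 2))"
        by (simp only: powr_of_real zero_le_power2)
      also have "((norm (u + s *\<^sub>R h))\<^sup>2) powr (\<alpha> / 2) = norm (u + s *\<^sub>R h) powr \<alpha>"
        by (simp add: powr_powr flip: powr_numeral)
      finally have "q (of_real s) powr complex_of_real (\<alpha> / 2) = complex_of_real (norm (u + s *\<^sub>R h) powr \<alpha>)" .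
      moreover have "m (of_real s) = monom_symbol bs (u + s *\<^sub>R h)"
        unfolding m_def monom_symbol_def by (simp add: inner_add_left)
      ultimately show ?thesis
        by (simp add: F_def centred_symbol_def flip: exp_of_real)
    qed
    show "norm (F z) \<le> 2 ^ (length bs + 1) * t * norm u ^ length bs * norm u powr \<alpha>" if z: "norm z < R" for z
    proof -
      have zh: "norm z * norm h \<le> norm u"
        using z h norm_ge_zero[of u] by (simp add: R_def field_simps del: norm_ge_zero) 
      have "norm (m z) \<le> (2 * norm u) ^ length bs"
        using bs unfolding m_def
      proof (induction bs)
        case (Cons b bs)
        have "norm (complex_of_real (u \<bullet> b) + z * complex_of_real (h \<bullet> b)) \<le> norm (u \<bullet> b) + norm z * norm (h \<bullet> b)"
          by (rule order_trans[OF norm_triangle_ineq]) (simp add: norm_mult)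
        also have "\<dots> \<le> norm u + norm z * norm h"
          using Cons.prems by (intro add_mono mult_left_mono) (auto simp: Basis_le_norm)
        finally have "norm (complex_of_real (u \<bullet> b) + z * complex_of_real (h \<bullet> b)) \<le> 2 * norm u"
          using zh by simp
        with Cons show ?case
          by (auto simp: norm_mult intro!: mult_mono)
      qed simp
      moreover have "norm (exp (- complex_of_real t * q z powr complex_of_real (\<alpha> / 2)) - 1) \<le> t * (2 * norm u powr \<alpha>)"
      proof -
        have "norm (exp (- complex_of_real t * q z powr complex_of_real (\<alpha> / 2)) - 1)
            \<le> norm (- complex_of_real t * q z powr complex_of_real (\<alpha> / 2))"
          using Re_powr_nonneg[OF q_pos[OF z], of "\<alpha> / 2"] \<alpha> t by (intro norm_exp_minus_1_le) auto
        also have "\<dots> = t * norm (q z) powr (\<alpha> / 2)"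
          using t by (simp add: norm_mult norm_powr_real_powr')
        also have "norm (q z) powr (\<alpha> / 2) \<le> (2 * (norm u)\<^sup>2) powr (\<alpha> / 2)"
          using q_le[OF z] \<alpha> by (intro powr_mono2) auto
        also have "\<dots> = 2 powr (\<alpha> / 2) * norm u powr \<alpha>"
          by (simp add: powr_mult powr_powr flip: powr_numeral)
        also have "\<dots> \<le> 2 powr 1 * norm u powr \<alpha>"
          using \<alpha> by (intro mult_right_mono powr_mono) auto
        finally show ?thesis using t by (simp add: mult_left_mono)
      qed
      ultimately have "norm (F z) \<le> (2 * norm u) ^ length bs * (t * (2 * norm u powr \<alpha>))"
        unfolding F_def norm_mult by (intro mult_mono) auto
      then show ?thesis by (simp add: power_mult_distrib mult_ac)
    qed
  qed
qed

text \<open>The disc of the holomorphic extension is divided into \<open>N + 1\<close> rings of width \<open>\<delta>\<close>; the assumption on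
  \<open>u\<close> says that \<open>\<delta> \<ge> 2\<close>.\<close>

lemma fwd_diff_iter_centred_symbol_far:
  fixes u h :: "'a::euclidean_space"
  assumes \<alpha>: "0 < \<alpha>" "\<alpha> < 2" and t: "0 \<le> t" and bs: "set bs \<subseteq> Basis" and h: "h \<noteq> 0"
    and u: "16 * real (N + 1) * norm h \<le> norm u"
  shows "norm ((fwd_diff h ^^ N) (centred_symbol \<alpha> t bs) u)
    \<le> 2 ^ (length bs + 1) * (16 * real (N + 1) * norm h) ^ N * t * (norm u ^ length bs * norm u powr \<alpha> / norm u ^ N)"
proof -
  let ?R = "norm u / (8 * norm h)" and ?M = "2 ^ (length bs + 1) * t * norm u ^ length bs * norm u powr \<alpha>"
  define \<delta> where "\<delta> = ?R / real (N + 1)"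
  have R: "\<delta> + real N * \<delta> = ?R"
  proof -
    have "\<delta> + real N * \<delta> = real (N + 1) * \<delta>" by (simp add: algebra_simps)
    also have "\<dots> = ?R" unfolding \<delta>_def by simp
    finally show ?thesis .
  qed
  have \<delta>: "2 \<le> \<delta>"
  proof -
    have "0 < 8 * norm h * real (N + 1)" using h by simp
    then show ?thesis
      unfolding \<delta>_def divide_divide_eq_left using u by (subst pos_le_divide_eq) (auto simp: mult_ac)
  qed
  have "u \<noteq> 0" using u h by (auto simp: mult_le_0_iff)
  from centred_symbol_holomorphic_extension[OF \<alpha> t bs h this] obtain F where
    F: "F holomorphic_on ball 0 ?R" "\<And>s::real. F (of_real s) = centred_symbol \<alpha> t bs (u + s *\<^sub>R h)"
      "\<And>z. norm z < ?R \<Longrightarrow> norm (F z) \<le> ?M"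
    by blast
  have "(fwd_diff h ^^ N) (centred_symbol \<alpha> t bs) u = (fwd_diff 1 ^^ N) F 0"
    using fwd_diff_iter_restrict[of F "centred_symbol \<alpha> t bs" u h N 0, OF F(2)] by simp
  also have "norm \<dots> \<le> ?M * (2 / \<delta>) ^ N"
    using F \<delta> by (intro fwd_diff_iter_holomorphic_le[of F \<delta>]) (auto simp: R)
  also have "2 / \<delta> = 16 * real (N + 1) * norm h / norm u"
    by (simp add: \<delta>_def)
  finally show ?thesis by (simp add: power_divide mult_ac)
qed

lemma fwd_diff_iter_centred_symbol_near:
  fixes u h :: "'a::euclidean_space"
  assumes \<alpha>: "0 < \<alpha>" and t: "0 \<le> t" and bs: "set bs \<subseteq> Basis" and u: "norm u \<le> A"
  shows "norm ((fwd_diff h ^^ N) (centred_symbol \<alpha> t bs) u)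
    \<le> 2 ^ N * ((A + real N * norm h) ^ length bs * (A + real N * norm h) powr \<alpha>) * t"
proof -
  let ?B = "A + real N * norm h"
  have "norm ((fwd_diff h ^^ N) (centred_symbol \<alpha> t bs) u) \<le> 2 ^ N * (t * ?B ^ length bs * ?B powr \<alpha>)"
  proof (rule fwd_diff_iter_norm_le)
    fix j assume "j \<le> N"
    then have "real j * norm h \<le> real N * norm h"
      by (intro mult_right_mono) auto
    then have v: "norm (u + real j *\<^sub>R h) \<le> ?B"
      using u norm_triangle_ineq[of u "real j *\<^sub>R h"] by simp
    have "norm (centred_symbol \<alpha> t bs (u + real j *\<^sub>R h))
        \<le> t * norm (u + real j *\<^sub>R h) ^ length bs * norm (u + real j *\<^sub>R h) powr \<alpha>"
      using bs t by (rule norm_centred_symbol_le)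
    also have "\<dots> \<le> t * ?B ^ length bs * ?B powr \<alpha>"
      using \<alpha> t v order_trans[OF norm_ge_zero v]
      by (intro mult_mono power_mono powr_mono2 mult_nonneg_nonneg) auto
    finally show "norm (centred_symbol \<alpha> t bs (u + real j *\<^sub>R h)) \<le> t * ?B ^ length bs * ?B powr \<alpha>" .
  qed
  then show ?thesis by (simp add: mult_ac)
qed

text \<open>An integrable function that bounds the differences of the symbol.  It is a product over the
  coordinates, which reduces its integrability to dimension one.\<close>

definition prod_cauchy :: "'a::euclidean_space \<Rightarrow> real" where
  "prod_cauchy u = (\<Prod>b\<in>Basis. inverse (1 + (u \<bullet> b)\<^sup>2))"

lemma integrable_prod_cauchy: "integrable lborel (prod_cauchy :: 'a::euclidean_space \<Rightarrow> real)"
  unfolding prod_cauchy_def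
  by (rule integrable_lborel_prod_Basis(1))
     (use integrable_inverse_1_plus_square in \<open>simp add: set_integrable_def\<close>)

lemma prod_cauchy_ge: "inverse (1 + (norm u)\<^sup>2) ^ DIM('a) \<le> prod_cauchy (u::'a::euclidean_space)"
proof -
  have "(\<Prod>b\<in>(Basis::'a set). inverse (1 + (norm u)\<^sup>2)) \<le> prod_cauchy u"
    unfolding prod_cauchy_def
  proof (intro prod_mono conjI le_imp_inverse_le add_left_mono)
    fix b :: 'a assume "b \<in> Basis"
    then show "(u \<bullet> b)\<^sup>2 \<le> (norm u)\<^sup>2"
      using Basis_le_norm[of b u] by (metis abs_norm_cancel abs_le_square_iff)
  qed (auto simp: add_pos_nonneg add_nonneg_nonneg)
  then show ?thesis by simp
qed

text \<open>With \<open>N = 2 * d + k + 2\<close> differences the bound away from the origin is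
  \<open>norm u powr (k + \<alpha> - N)\<close>, which is at most \<open>norm u\<close> to the power \<open>- 2 * d\<close> because \<open>\<alpha> < 2\<close>; this is
  the decay of \<open>prod_cauchy\<close> along the diagonals, where that function decays fastest.\<close>

lemma fwd_diff_iter_centred_symbol_le:
  fixes \<alpha> :: real
  assumes \<alpha>: "0 < \<alpha>" "\<alpha> < 2" and N: "N = 2 * DIM('a) + k + 2"
  shows "\<exists>C\<ge>0. \<forall>t bs u h. 0 \<le> t \<longrightarrow> set bs \<subseteq> (Basis :: 'a::euclidean_space set) \<longrightarrow> length bs = k \<longrightarrow> norm h = pi \<longrightarrow>
    norm ((fwd_diff h ^^ N) (centred_symbol \<alpha> t bs) u) \<le> C * t * prod_cauchy u"
proof -
  \<comment> \<open>The threshold from which on the estimate by holomorphic extension applies.\<close>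
  define A where "A = 16 * real (N + 1) * pi"
  define C\<^sub>1 where "C\<^sub>1 = 2 ^ N * ((A + real N * pi) ^ k * (A + real N * pi) powr \<alpha>) * (1 + A\<^sup>2) ^ DIM('a)"
  define C\<^sub>2 where "C\<^sub>2 = 2 ^ (k + 1) * A ^ N * 2 ^ DIM('a)"
  have A: "1 \<le> A"
  proof -
    have "1 * 1 \<le> (16 * real (N + 1)) * pi" using pi_ge_two by (intro mult_mono) auto
    then show ?thesis by (simp add: A_def)
  qed
  have C: "0 \<le> C\<^sub>1" "0 \<le> C\<^sub>2" using A by (auto simp: C\<^sub>1_def C\<^sub>2_def)
  have pc: "0 \<le> prod_cauchy u" for u :: 'a
    by (auto simp: prod_cauchy_def intro!: prod_nonneg)
  have "norm ((fwd_diff h ^^ N) (centred_symbol \<alpha> t bs) u) \<le> (C\<^sub>1 + C\<^sub>2) * t * prod_cauchy u"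
    if t: "0 \<le> t" and bs: "set bs \<subseteq> Basis" "length bs = k" and h: "norm h = pi" for t bs and u h :: 'a
  proof (cases "norm u \<le> A")
    case True
    have "1 \<le> ((1 + A\<^sup>2) * inverse (1 + (norm u)\<^sup>2)) ^ DIM('a)"
    proof (rule one_le_power)
      have "(norm u)\<^sup>2 \<le> A\<^sup>2" using True by (intro power_mono) auto
      then show "1 \<le> (1 + A\<^sup>2) * inverse (1 + (norm u)\<^sup>2)"
        by (simp add: field_simps add_pos_nonneg)
    qed
    also have "\<dots> \<le> (1 + A\<^sup>2) ^ DIM('a) * prod_cauchy u"
      unfolding power_mult_distrib using prod_cauchy_ge[of u] by (intro mult_left_mono) auto
    finally have 1: "1 \<le> (1 + A\<^sup>2) ^ DIM('a) * prod_cauchy u" .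
    have "norm ((fwd_diff h ^^ N) (centred_symbol \<alpha> t bs) u)
      \<le> 2 ^ N * ((A + real N * pi) ^ k * (A + real N * pi) powr \<alpha>) * t"
      using fwd_diff_iter_centred_symbol_near[OF \<alpha>(1) t bs(1) True, of N h] by (simp add: h bs)
    also have "\<dots> \<le> 2 ^ N * ((A + real N * pi) ^ k * (A + real N * pi) powr \<alpha>) * t * ((1 + A\<^sup>2) ^ DIM('a) * prod_cauchy u)"
      using A t mult_left_mono[OF 1, of "2 ^ N * ((A + real N * pi) ^ k * (A + real N * pi) powr \<alpha>) * t"]
      by simp
    also have "\<dots> = C\<^sub>1 * t * prod_cauchy u"
      by (simp add: C\<^sub>1_def mult_ac)
    also have "\<dots> \<le> (C\<^sub>1 + C\<^sub>2) * t * prod_cauchy u"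
      using C t pc by (intro mult_right_mono) auto
    finally show ?thesis .
  next
    case False
    then have u: "A \<le> norm u" and u1: "1 \<le> norm u" using A by auto
    have "norm u ^ k * norm u powr \<alpha> / norm u ^ N \<le> norm u ^ k * (norm u)\<^sup>2 / norm u ^ N"
    proof -
      have "norm u powr \<alpha> \<le> norm u powr 2" using \<alpha> u1 by (intro powr_mono) auto
      then have "norm u powr \<alpha> \<le> (norm u)\<^sup>2" using u1 by simp
      then show ?thesis by (intro divide_right_mono mult_left_mono) auto
    qed
    also have "\<dots> = inverse ((norm u)\<^sup>2) ^ DIM('a)"
    proof -
      have "norm u ^ N = norm u ^ k * (norm u)\<^sup>2 * ((norm u)\<^sup>2) ^ DIM('a)"
        unfolding N power_add power_mult by (simp only: mult_ac)
      moreover have "norm u ^ k * (norm u)\<^sup>2 \<noteq> 0" using u1 by auto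
      ultimately show ?thesis
        by (simp only: power_inverse) (simp add: field_simps)
    qed
    also have "\<dots> \<le> (2 * inverse (1 + (norm u)\<^sup>2)) ^ DIM('a)"
    proof (rule power_mono)
      have *: "inverse s \<le> 2 * inverse (1 + s)" if "1 \<le> s" for s :: real
        using that by (simp add: field_simps)
      show "inverse ((norm u)\<^sup>2) \<le> 2 * inverse (1 + (norm u)\<^sup>2)"
        by (rule *) (use u1 in \<open>simp\<close>)
    qed auto
    also have "\<dots> \<le> 2 ^ DIM('a) * prod_cauchy u"
      unfolding power_mult_distrib using prod_cauchy_ge[of u] by (intro mult_left_mono) auto
    finally have 1: "norm u ^ k * norm u powr \<alpha> / norm u ^ N \<le> 2 ^ DIM('a) * prod_cauchy u" .
    have "h \<noteq> 0" using h pi_gt_zero by auto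
    from fwd_diff_iter_centred_symbol_far[OF \<alpha> t bs(1) this, of N u] u
    have "norm ((fwd_diff h ^^ N) (centred_symbol \<alpha> t bs) u)
      \<le> 2 ^ (k + 1) * A ^ N * t * (norm u ^ k * norm u powr \<alpha> / norm u ^ N)"
      by (simp only: A_def h bs(2))
    also have "\<dots> \<le> 2 ^ (k + 1) * A ^ N * t * (2 ^ DIM('a) * prod_cauchy u)"
      using A t by (intro mult_left_mono[OF 1]) auto
    also have "\<dots> = C\<^sub>2 * t * prod_cauchy u"
      by (simp add: C\<^sub>2_def mult_ac)
    also have "\<dots> \<le> (C\<^sub>1 + C\<^sub>2) * t * prod_cauchy u"
      using C t pc by (intro mult_right_mono) auto
    finally show ?thesis .
  qed
  with C show ?thesis by (intro exI[of _ "C\<^sub>1 + C\<^sub>2"]) auto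
qed

section \<open>Decay of the density and its derivatives\<close>

text \<open>Small times are the essential case: the bound tends to \<open>0\<close> with \<open>t\<close>, while the \<open>L\<^sup>1\<close> norm of the
  symbol blows up.\<close>

lemma fourier_stable_symbol_unit_le:
  fixes \<alpha> :: real
  assumes \<alpha>: "0 < \<alpha>" "\<alpha> < 2"
  shows "\<exists>C\<ge>0. \<forall>t bs e. 0 < t \<longrightarrow> set bs \<subseteq> (Basis :: 'a::euclidean_space set) \<longrightarrow> length bs = k \<longrightarrow> norm e = 1 \<longrightarrow>
    norm (fourier (stable_symbol \<alpha> t bs) e) \<le> C * t"
proof -
  define N where "N = 2 * DIM('a) + k + 2"
  obtain C where C: "0 \<le> C" "\<And>t bs u h. \<lbrakk>0 \<le> t; set bs \<subseteq> Basis; length bs = k; norm h = pi\<rbrakk> \<Longrightarrow>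
      norm ((fwd_diff h ^^ N) (centred_symbol \<alpha> t bs) (u::'a)) \<le> C * t * prod_cauchy u"
    using fwd_diff_iter_centred_symbol_le[OF \<alpha> N_def] by blast
  let ?C = "C * (LINT u|lborel. prod_cauchy (u::'a))"
  have "norm (fourier (stable_symbol \<alpha> t bs) e) \<le> ?C * t"
    if t: "0 < t" and bs: "set bs \<subseteq> Basis" "length bs = k" and e: "norm e = 1" for t bs and e :: 'a
  proof -
    let ?w = "stable_symbol \<alpha> t bs" and ?h = "pi *\<^sub>R e"
    have "?h \<bullet> e = pi" using e by (simp add: norm_eq_1)
    then have "iexp (?h \<bullet> e) - 1 = -2" by (simp only: exp_pi_i' ) simp
    with fourier_fwd_diff_iter(2)[OF integrable_stable_symbol[OF \<alpha>(1) t bs(1)], of N ?h e]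
    have "fourier ((fwd_diff ?h ^^ N) ?w) e = (-2) ^ N * fourier ?w e"
      by (simp only:)
    then have "2 ^ N * norm (fourier ?w e) = norm (fourier ((fwd_diff ?h ^^ N) ?w) e)"
      by (simp add: norm_mult norm_power)
    also have "\<dots> \<le> (LINT u|lborel. norm ((fwd_diff ?h ^^ N) ?w u))"
      by (intro norm_fourier_le fourier_fwd_diff_iter integrable_stable_symbol \<alpha> t bs)
    also have "\<dots> \<le> (LINT u|lborel. C * t * prod_cauchy (u::'a))"
    proof (rule integral_mono)
      show "integrable lborel (\<lambda>u. norm ((fwd_diff ?h ^^ N) ?w u))"
        by (intro integrable_norm fourier_fwd_diff_iter integrable_stable_symbol \<alpha> t bs)
      show "integrable lborel (\<lambda>u::'a. C * t * prod_cauchy u)"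
        by (intro integrable_mult_right integrable_prod_cauchy)
      have "(fwd_diff ?h ^^ N) ?w = (fwd_diff ?h ^^ N) (centred_symbol \<alpha> t bs)"
        by (rule fwd_diff_iter_stable_symbol) (simp add: N_def bs)
      then show "norm ((fwd_diff ?h ^^ N) ?w u) \<le> C * t * prod_cauchy u" for u
        using C(2)[of t bs ?h u] t bs e by simp
    qed
    also have "\<dots> = ?C * t" by simp
    finally have "2 ^ N * norm (fourier ?w e) \<le> ?C * t" .
    moreover have "1 * norm (fourier ?w e) \<le> 2 ^ N * norm (fourier ?w e)"
      by (intro mult_right_mono) auto
    ultimately show ?thesis by simp
  qed
  moreover have "0 \<le> ?C"
    using C(1) by (auto simp: prod_cauchy_def intro!: mult_nonneg_nonneg prod_nonneg integral_nonneg_AE)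
  ultimately show ?thesis by blast
qed

text \<open>On \<open>norm x \<le> \<rho>\<close>, where \<open>\<rho> = t powr (1 / \<alpha>)\<close> is the length scale at time \<open>t\<close>, the minimum is \<open>1\<close> and
  scaling by \<open>\<rho>\<close> gives the bound; elsewhere scaling by \<open>norm x\<close> gives it.\<close>

lemma stable_density_partials_le:
  fixes \<alpha> :: real
  assumes \<alpha>: "0 < \<alpha>" "\<alpha> < 2"
  shows "\<exists>C>0. \<forall>t bs x. 0 < t \<longrightarrow> set bs \<subseteq> (Basis :: 'a::euclidean_space set) \<longrightarrow> length bs = k \<longrightarrow> x \<noteq> 0 \<longrightarrow>
    \<bar>partials bs (stable_density \<alpha> t 0) x\<bar>
      \<le> C * t powr - ((DIM('a) + k) / \<alpha>) * min 1 (t powr (1 / \<alpha>) * inverse (norm x)) powr (DIM('a) + \<alpha> + k)"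
proof -
  obtain C where C: "0 \<le> C" "\<And>t bs e. \<lbrakk>0 < t; set bs \<subseteq> Basis; length bs = k; norm e = 1\<rbrakk> \<Longrightarrow>
      norm (fourier (stable_symbol \<alpha> t bs) (e::'a)) \<le> C * t"
    using fourier_stable_symbol_unit_le[OF \<alpha>] by blast
  define K where "K = (LINT u|lborel. norm (u::'a) ^ k * exp (- (norm u powr \<alpha>)))"
  have K: "0 \<le> K" unfolding K_def by simp
  define D where "D = C + K + 1"
  have D: "0 < D" "C \<le> D" "K \<le> D" using C K by (auto simp: D_def)
  let ?n = "DIM('a) + k"
  have "\<bar>partials bs (stable_density \<alpha> t 0) x\<bar>
      \<le> D * t powr - (?n / \<alpha>) * min 1 (t powr (1 / \<alpha>) * inverse (norm x)) powr (DIM('a) + \<alpha> + k)"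
    if t: "0 < t" and bs: "set bs \<subseteq> Basis" "length bs = k" and x: "x \<noteq> 0" for t bs and x :: 'a
  proof -
    define \<rho> where "\<rho> = t powr (1 / \<alpha>)"
    have \<rho>: "0 < \<rho>" "\<rho> powr \<alpha> = t" using t \<alpha> by (auto simp: \<rho>_def powr_powr)
    have \<rho>n: "t powr - (?n / \<alpha>) = inverse \<rho> ^ ?n"
    proof -
      have "t powr - (?n / \<alpha>) = \<rho> powr - real ?n"
        by (simp add: \<rho>_def powr_powr minus_divide_left)
      then show ?thesis using \<rho> by (simp only: powr_minus powr_realpow power_inverse)
    qed
    let ?F = "fourier (stable_symbol \<alpha> t bs) x"
    have "partials bs (stable_density \<alpha> t 0) x = Re ?F / (2 * pi) ^ DIM('a)"
      using stable_density_partials(1)[OF \<alpha>(1) t bs(1)] by simp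
    also have "\<bar>\<dots>\<bar> \<le> \<bar>Re ?F\<bar> / 1"
    proof -
      have "1 \<le> (2 * pi) ^ DIM('a)" using pi_ge_two by (intro one_le_power) auto
      then show ?thesis unfolding abs_divide by (intro divide_left_mono) auto
    qed
    also have "\<dots> \<le> norm ?F" using abs_Re_le_cmod by simp
    finally have "\<bar>partials bs (stable_density \<alpha> t 0) x\<bar> \<le> norm ?F" .
    also have "\<dots> \<le> D * inverse \<rho> ^ ?n * min 1 (\<rho> * inverse (norm x)) powr (DIM('a) + \<alpha> + k)"
    proof (cases "norm x \<le> \<rho>")
      case True
      have one: "t * \<rho> powr - \<alpha> = 1" using t by (simp add: powr_minus \<rho>)
      have "norm ?F = inverse \<rho> ^ ?n * norm (fourier (stable_symbol \<alpha> 1 bs) (x /\<^sub>R \<rho>))"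
        using \<rho> by (subst fourier_stable_symbol_scale[OF \<rho>(1)]) (simp add: norm_mult norm_power norm_inverse one bs)
      also have "\<dots> \<le> inverse \<rho> ^ ?n * K"
      proof (intro mult_left_mono)
        have "norm (fourier (stable_symbol \<alpha> 1 bs) (x /\<^sub>R \<rho>)) \<le> (LINT u|lborel. norm (stable_symbol \<alpha> 1 bs u))"
          by (intro norm_fourier_le integrable_stable_symbol \<alpha> bs) auto
        also have "\<dots> \<le> K"
          unfolding K_def
          using norm_stable_symbol_le[OF bs(1), of \<alpha> 1] integrable_power_mult_exp_neg_norm_powr[of \<alpha> 1 k, where 'a='a] \<alpha>
          by (intro integral_mono integrable_norm integrable_stable_symbol) (auto simp: bs)
        finally show "norm (fourier (stable_symbol \<alpha> 1 bs) (x /\<^sub>R \<rho>)) \<le> K" .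
      qed (use \<rho> in auto)
      also have "\<dots> \<le> D * inverse \<rho> ^ ?n"
        using D \<rho> by (subst mult.commute) (intro mult_right_mono, auto)
      also have "min 1 (\<rho> * inverse (norm x)) = 1"
        using True x by (simp add: field_simps)
      then have "D * inverse \<rho> ^ ?n = D * inverse \<rho> ^ ?n * min 1 (\<rho> * inverse (norm x)) powr (DIM('a) + \<alpha> + k)"
        by simp
      finally show ?thesis .
    next
      case False
      let ?r = "norm x"
      have r: "0 < ?r" using x by simp
      have "norm ?F = inverse ?r ^ ?n * norm (fourier (stable_symbol \<alpha> (t * ?r powr - \<alpha>) bs) (x /\<^sub>R ?r))"
        by (subst fourier_stable_symbol_scale[OF r]) (simp add: norm_mult norm_power norm_inverse bs)
      also have "\<dots> \<le> inverse ?r ^ ?n * (C * (t * ?r powr - \<alpha>))"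
        using t r bs by (intro mult_left_mono C) auto
      also have "\<dots> \<le> inverse ?r ^ ?n * (D * (t * ?r powr - \<alpha>))"
        using t D by (intro mult_left_mono mult_right_mono) auto
      also have "\<dots> = D * inverse \<rho> ^ ?n * (\<rho> * inverse ?r) powr (DIM('a) + \<alpha> + k)"
      proof -
        have "(\<rho> * inverse ?r) powr (DIM('a) + \<alpha> + k) = (\<rho> * inverse ?r) powr (real ?n + \<alpha>)"
          by (simp add: algebra_simps)
        also have "\<dots> = (\<rho> * inverse ?r) ^ ?n * (\<rho> powr \<alpha> * inverse ?r powr \<alpha>)"
          using \<rho> r by (simp only: powr_add powr_mult powr_realpow power_mult_distrib mult_pos_pos positive_imp_inverse_positive)
        also have "\<dots> = \<rho> ^ ?n * inverse ?r ^ ?n * (t * ?r powr - \<alpha>)"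
          using r by (simp only: \<rho>(2) power_mult_distrib inverse_powr powr_minus)
        finally show ?thesis using \<rho> by (simp add: mult_ac power_inverse)
      qed
      also have "\<rho> * inverse ?r = min 1 (\<rho> * inverse ?r)"
        using False r by (simp add: min_def field_simps)
      finally show ?thesis .
    qed
    finally show ?thesis unfolding \<rho>n \<rho>_def .
  qed
  with D(1) show ?thesis by blast
qed

theorem proposition4p1:
  fixes \<alpha> :: real
  assumes "0 < \<alpha>" and "\<alpha> < 2"
  shows "\<exists>c\<^sub>1>0. \<forall>x::'a::euclidean_space. x \<noteq> 0 \<longrightarrow>
     (\<bar>stable_density \<alpha> 1 0 x\<bar> \<le> c\<^sub>1 * min 1 (norm x powr - (DIM('a) + \<alpha>)) \<and>
      (\<forall>k\<in>{1, 2::nat}. \<forall>bs. set bs \<subseteq> Basis \<and> length bs = k \<longrightarrow>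
         partials_exist bs (stable_density \<alpha> 1 0) x \<and>
         \<bar>partials bs (stable_density \<alpha> 1 0) x\<bar>
           \<le> c\<^sub>1 * min 1 (norm x powr - (DIM('a) + \<alpha> + k)))) \<and>
     (\<forall>t>0.
      \<bar>stable_density \<alpha> t 0 x\<bar>
        \<le> c\<^sub>1 * t powr - (DIM('a) / \<alpha>)
           * min 1 (t powr (1 / \<alpha>) * inverse (norm x)) powr (DIM('a) + \<alpha>) \<and>
      (\<forall>k\<in>{1, 2::nat}. \<forall>bs. set bs \<subseteq> Basis \<and> length bs = k \<longrightarrow>
         partials_exist bs (stable_density \<alpha> t 0) x \<and>
         \<bar>partials bs (stable_density \<alpha> t 0) x\<bar>
           \<le> c\<^sub>1 * t powr - ((DIM('a) + k) / \<alpha>)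
              * min 1 (t powr (1 / \<alpha>) * inverse (norm x)) powr (DIM('a) + \<alpha> + k)))"
proof -
  let ?R = "\<lambda>t (x::'a) k. t powr - ((DIM('a) + k) / \<alpha>)
      * min 1 (t powr (1 / \<alpha>) * inverse (norm x)) powr (DIM('a) + \<alpha> + real k)"
  obtain C :: "nat \<Rightarrow> real" where C: "\<And>k. 0 < C k"
    and le: "\<And>t bs x. \<lbrakk>0 < t; set bs \<subseteq> Basis; x \<noteq> 0\<rbrakk> \<Longrightarrow>
      \<bar>partials bs (stable_density \<alpha> t 0) x\<bar> \<le> C (length bs) * ?R t x (length bs)"
    using stable_density_partials_le[OF assms, where 'a='a] unfolding mult.assoc by metis
  define c where "c = C 0 + C 1 + C 2"
  have c: "0 < c" "C k \<le> c" if "k \<in> {0, 1, 2}" for k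
    using that C[of 0] C[of 1] C[of 2] by (auto simp: c_def)
  have B: "\<bar>partials bs (stable_density \<alpha> t 0) x\<bar> \<le> c * ?R t x k"
    if "0 < t" "set bs \<subseteq> Basis" "length bs = k" "k \<in> {0, 1, 2}" "x \<noteq> 0" for t bs k and x :: 'a
    using le[OF that(1,2,5)] c(2)[OF that(4)] that(3)
    by (elim order_trans) (auto intro!: mult_right_mono)
  \<comment> \<open>At time 1 the two forms of the right-hand side coincide.\<close>
  have one: "?R 1 x k = min 1 (norm x powr - (DIM('a) + \<alpha> + k))" if "x \<noteq> 0" for x :: 'a and k
  proof (cases "norm x \<le> 1")
    case True
    then have "norm x powr 0 \<le> norm x powr - (DIM('a) + \<alpha> + k)"
      using assms by (intro powr_mono') auto
    moreover have "min 1 (inverse (norm x)) = 1" using True that by (simp add: field_simps)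
    ultimately show ?thesis using that by simp
  next
    case False
    then have "norm x powr - (DIM('a) + \<alpha> + k) \<le> norm x powr 0"
      using assms by (intro powr_mono) auto
    then have le1: "norm x powr - (DIM('a) + \<alpha> + k) \<le> 1"
      using that by simp
    have "min 1 (inverse (norm x)) = inverse (norm x)"
      using False that by (simp add: min_def field_simps)
    then have "?R 1 x k = inverse (norm x) powr (DIM('a) + \<alpha> + k)"
      by simp
    also have "\<dots> = norm x powr - (DIM('a) + \<alpha> + k)"
      by (simp only: powr_minus inverse_powr)
    also have "\<dots> = min 1 (norm x powr - (DIM('a) + \<alpha> + k))"
      using le1 by (rule min_absorb2[symmetric])
    finally show ?thesis .
  qed
  have ex: "partials_exist bs (stable_density \<alpha> t 0) x" if "0 < t" "set bs \<subseteq> Basis" for t bs and x :: 'a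
    using assms(1) that by (rule stable_density_partials(2))
  show ?thesis
  proof (intro exI[of _ c] conjI allI impI ballI)
    show "0 < c" using c(1)[of 0] by simp
  next
    fix x :: 'a assume x: "x \<noteq> 0"
    show "\<bar>stable_density \<alpha> 1 0 x\<bar> \<le> c * min 1 (norm x powr - (DIM('a) + \<alpha>))"
      using B[of 1 "[]" 0 x] one[of x 0] x by simp
  next
    fix x :: 'a and k bs assume "x \<noteq> 0" "k \<in> {1, 2::nat}" "set bs \<subseteq> (Basis::'a set) \<and> length bs = k"
    then show "\<bar>partials bs (stable_density \<alpha> 1 0) x\<bar> \<le> c * min 1 (norm x powr - (DIM('a) + \<alpha> + k))"
      using B[of 1 bs k x] by (simp only: one) simp
  next
    fix x :: 'a and t :: real assume "x \<noteq> 0" "0 < t"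
    then show "\<bar>stable_density \<alpha> t 0 x\<bar> \<le> c * t powr - (DIM('a) / \<alpha>)
           * min 1 (t powr (1 / \<alpha>) * inverse (norm x)) powr (DIM('a) + \<alpha>)"
      using B[of t "[]" 0 x] by (simp add: mult.assoc)
  next
    fix x :: 'a and t :: real and k bs
    assume "x \<noteq> 0" "0 < t" "k \<in> {1, 2::nat}" "set bs \<subseteq> (Basis::'a set) \<and> length bs = k"
    then show "\<bar>partials bs (stable_density \<alpha> t 0) x\<bar> \<le> c * t powr - ((DIM('a) + k) / \<alpha>)
           * min 1 (t powr (1 / \<alpha>) * inverse (norm x)) powr (DIM('a) + \<alpha> + k)"
      using B[of t bs k x] by (auto simp: mult.assoc)
  qed (auto intro: ex)
qed

end
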